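(* Let $\Omega\subseteq\mathbb{R}^n$ be open, $\nu,C_1,\dots,C_{n-1}\in\mathcal{C}^\infty(\Omega,\mathbb{R})$, $H:=C_{n-1}$, and $X$ the vector field on $\Omega$ with components $X_i=\nu\cdot\frac{\partial(C_1,\dots,C_{n-2},x_i,H)}{\partial(x_1,\dots,x_n)}$. Let $\overline{x}_e\in\mathcal{E}^{C_{n-1}}_{C_1,\dots,C_{n-2}}$ be a non-degenerate regular equilibrium point of $X$. If $\mathcal{I}_X(\overline{x}_e)>0$, then $\overline{x}_e$ is a Lyapunov stable equilibrium of $X$.
   Context: $\langle\cdot,\cdot\rangle$ is the standard inner product on $\mathbb{R}^n$, $\nabla$ the gradient, and $\frac{\partial(\cdots)}{\partial(x_1,\dots,x_n)}$ a Jacobian determinant. For decomposable $k$-vectors, $\langle u_1\wedge\dots\wedge u_k,v_1\wedge\dots\wedge v_k\rangle_k:=\det[\langle u_i,v_j\rangle]$. $\mathcal{E}^{C_{n-1}}_{C_1,\dots,C_{n-2}}:=\{\overline{x}\in\Omega:\nu(\overline{x})\neq0,\ \nabla C_1\wedge\dots\wedge\nabla C_{n-2}(\overline{x})\neq0,\ \nabla C_1\wedge\dots\wedge\nabla C_{n-1}(\overline{x})=0\}$. For $\overline{x}_e$ in it, let $\overrightarrow{\lambda_e}\in\mathbb{R}^{n-2}$ be the unique vector with $\nabla H(\overline{x}_e)+\sum_i\lambda^e_i\nabla C_i(\overline{x}_e)=0$, $F_{\overrightarrow{\lambda_e}}:=H+\sum_i\lambda^e_iC_i$; $\overline{x}_e$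 is non-degenerate if $A:=\operatorname{Hess}F_{\overrightarrow{\lambda_e}}(\overline{x}_e)=\mathrm{D}(\nabla F_{\overrightarrow{\lambda_e}})(\overline{x}_e)$ is invertible, and then $\mathcal{I}_X(\overline{x}_e):=\nu^2(\overline{x}_e)\det(A)\langle A^{-1}\nabla C_1(\overline{x}_e)\wedge\dots\wedge A^{-1}\nabla C_{n-2}(\overline{x}_e),\nabla C_1(\overline{x}_e)\wedge\dots\wedge\nabla C_{n-2}(\overline{x}_e)\rangle_{n-2}$. *)

theory Defs
  imports "HOL-Analysis.Analysis"
begin

text \<open>Points of R^n are vectors real^'n; the coordinates x_1,...,x_n are the elements
of the finite index type 'n listed in increasing order of its well-order.
The (0-based) position of coordinate i is its rank.\<close>

definition rank :: "'n::{finite,wellorder} \<Rightarrow> nat" where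
  "rank i = card {j. j < i}"

definition pd :: "'n::finite \<Rightarrow> (real^'n \<Rightarrow> real) \<Rightarrow> real^'n \<Rightarrow> real" where
  "pd j f x = frechet_derivative f (at x) (axis j 1)"

definition Cinf :: "(real^'n::finite) set \<Rightarrow> (real^'n \<Rightarrow> real) \<Rightarrow> bool" where
  "Cinf \<Omega> f \<longleftrightarrow> (\<forall>js::'n list. (foldr pd js f) differentiable_on \<Omega>)"

definition grad :: "(real^'n::finite \<Rightarrow> real) \<Rightarrow> real^'n \<Rightarrow> real^'n" where
  "grad f x = (\<chi> j. pd j f x)"

definition hess :: "(real^'n::finite \<Rightarrow> real) \<Rightarrow> real^'n \<Rightarrow> real^'n^'n" where
  "hess f x = (\<chi> i j. pd j (pd i f) x)"

definition jacdet :: "(nat \<Rightarrow> (real,'n::{finite,wellorder}) vec \<Rightarrow> real) \<Rightarrow> (real,'n) vec \<Rightarrow> real" where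
  "jacdet fs x = det (\<chi> i j. grad (fs (rank i + 1)) x $ j)"

definition det_nat :: "nat \<Rightarrow> (nat \<Rightarrow> nat \<Rightarrow> real) \<Rightarrow> real" where
  "det_nat k M = (\<Sum>p | p permutes {0..<k}. of_int (sign p) * (\<Prod>i<k. M i (p i)))"

text \<open>Inner product of k-vectors: <u_1 wedge ... wedge u_k, v_1 wedge ... wedge v_k>_k
 = det [<u_i, v_j>] (vectors indexed 0..k-1).\<close>
definition wedge_inner :: "nat \<Rightarrow> (nat \<Rightarrow> real^'n::finite) \<Rightarrow> (nat \<Rightarrow> real^'n) \<Rightarrow> real" where
  "wedge_inner k u v = det_nat k (\<lambda>a b. u a \<bullet> v b)"

definition vfX :: "((real,'n::{finite,wellorder}) vec \<Rightarrow> real) \<Rightarrow> (nat \<Rightarrow> (real,'n) vec \<Rightarrow> real) \<Rightarrow> (real,'n) vec \<Rightarrow> (real,'n) vec" where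
  "vfX \<nu> C x = (\<chi> i. \<nu> x * jacdet
      (\<lambda>k. if k \<le> CARD('n) - 2 then C k
           else if k = CARD('n) - 1 then (\<lambda>y. y $ i) else C (CARD('n) - 1)) x)"

text \<open>The set E^{C_{n-1}}_{C_1,...,C_{n-2}}; a k-vector w is nonzero iff <w,w>_k is nonzero.\<close>
definition Eset :: "(real^'n::finite) set \<Rightarrow> (real^'n \<Rightarrow> real) \<Rightarrow> (nat \<Rightarrow> real^'n \<Rightarrow> real) \<Rightarrow> (real^'n) set" where
  "Eset \<Omega> \<nu> C = {x \<in> \<Omega>. \<nu> x \<noteq> 0
      \<and> wedge_inner (CARD('n) - 2) (\<lambda>k. grad (C (k+1)) x) (\<lambda>k. grad (C (k+1)) x) \<noteq> 0
      \<and> wedge_inner (CARD('n) - 1) (\<lambda>k. grad (C (k+1)) x) (\<lambda>k. grad (C (k+1)) x) = 0}"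

definition lam :: "(nat \<Rightarrow> real^'n::finite \<Rightarrow> real) \<Rightarrow> real^'n \<Rightarrow> nat \<Rightarrow> real" where
  "lam C xe = (THE l. (\<forall>k. k \<notin> {1..CARD('n) - 2} \<longrightarrow> l k = 0) \<and>
      grad (C (CARD('n) - 1)) xe + (\<Sum>k=1..CARD('n) - 2. l k *\<^sub>R grad (C k) xe) = 0)"

definition Flam :: "(nat \<Rightarrow> real^'n::finite \<Rightarrow> real) \<Rightarrow> real^'n \<Rightarrow> real^'n \<Rightarrow> real" where
  "Flam C xe = (\<lambda>x. C (CARD('n) - 1) x + (\<Sum>k=1..CARD('n) - 2. lam C xe k * C k x))"

definition hessA :: "(nat \<Rightarrow> real^'n::finite \<Rightarrow> real) \<Rightarrow> real^'n \<Rightarrow> real^'n^'n" where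
  "hessA C xe = hess (Flam C xe) xe"

definition non_degenerate :: "(nat \<Rightarrow> real^'n::finite \<Rightarrow> real) \<Rightarrow> real^'n \<Rightarrow> bool" where
  "non_degenerate C xe \<longleftrightarrow> invertible (hessA C xe)"

definition IX :: "(real^'n::finite \<Rightarrow> real) \<Rightarrow> (nat \<Rightarrow> real^'n \<Rightarrow> real) \<Rightarrow> real^'n \<Rightarrow> real" where
  "IX \<nu> C xe = (\<nu> xe)\<^sup>2 * det (hessA C xe) *
     wedge_inner (CARD('n) - 2) (\<lambda>k. matrix_inv (hessA C xe) *v grad (C (k+1)) xe)
                                (\<lambda>k. grad (C (k+1)) xe)"

definition lyapunov_stable :: "(real^'n::finite) set \<Rightarrow> (real^'n \<Rightarrow> real^'n) \<Rightarrow> real^'n \<Rightarrow> bool" where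
  "lyapunov_stable \<Omega> X xe \<longleftrightarrow> (\<forall>\<epsilon>>0. \<exists>\<delta>>0. \<forall>x0. dist x0 xe < \<delta> \<longrightarrow>
      (\<exists>\<phi>. \<phi> 0 = x0 \<and> (\<forall>t\<ge>0. \<phi> t \<in> \<Omega> \<and> (\<phi> has_vector_derivative X (\<phi> t)) (at t within {0..}))) \<and>
      (\<forall>\<phi> T. \<phi> 0 = x0 \<and> (\<forall>t\<in>{0..T}. \<phi> t \<in> \<Omega> \<and> (\<phi> has_vector_derivative X (\<phi> t)) (at t within {0..T}))
          \<longrightarrow> (\<forall>t\<in>{0..T}. dist (\<phi> t) xe < \<epsilon>)))"

end

theory Submission
  imports Defs
begin

text \<open>
  Every \<open>C\<^sub>k\<close> with \<open>k < n\<close> is constant along the solutions of \<open>X\<close>: the derivative is a multiple of a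
  determinant with two equal rows. Hence \<open>V = \<Sum>\<^sub>k (C\<^sub>k - C\<^sub>k(x\<^sub>e))\<^sup>2\<close> is conserved, and it suffices that
  \<open>x\<^sub>e\<close> is an isolated zero of \<open>V\<close>. If zeros \<open>x\<^sub>m \<noteq> x\<^sub>e\<close> converged to \<open>x\<^sub>e\<close>, a limit \<open>u\<close> of the unit
  vectors along \<open>x\<^sub>m - x\<^sub>e\<close> would be orthogonal to \<open>\<nabla>C\<^sub>1, \<dots>, \<nabla>C\<^sub>n\<^sub>-\<^sub>2\<close> and isotropic for the Hessian
  \<open>A\<close> of \<open>F = H + \<Sum>\<^sub>i \<lambda>\<^sub>i C\<^sub>i\<close>. The invariant is a nonnegative multiple of the determinant of \<open>A\<close>
  restricted to the plane orthogonal to the gradients, so its positivity makes \<open>A\<close> definite there.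
  Near \<open>x\<^sub>e\<close> the field is Lipschitz; precomposing it with the projection onto a ball gives global
  solutions, and conservation of \<open>V\<close> keeps those starting near \<open>x\<^sub>e\<close> inside the ball, where they solve
  the original equation.
\<close>

section \<open>Gram determinants\<close>

lemma rank_bij: "bij_betw (rank :: 'n::{finite,wellorder} \<Rightarrow> nat) UNIV {0..<CARD('n)}"
proof -
  have *: "{j. j < i} \<noteq> UNIV" for i :: 'n using less_irrefl[of i] by blast
  have mono: "rank i < rank j" if "i < j" for i j :: 'n
    unfolding rank_def using that by (intro psubset_card_mono) auto
  have "inj (rank :: 'n \<Rightarrow> nat)"
    by (metis injI less_irrefl linorder_neqE mono)
  moreover have "range (rank :: 'n \<Rightarrow> nat) \<subseteq> {0..<CARD('n)}"
    unfolding rank_def by (auto intro!: psubset_card_mono simp: *)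
  ultimately show ?thesis
    by (metis bij_betw_def card_atLeastLessThan card_image card_subset_eq diff_zero
        finite_atLeastLessThan)
qed

lemma rank_less: "rank (i :: 'n::{finite,wellorder}) < CARD('n)"
  using bij_betw_apply[OF rank_bij, of i] by simp

lemma rank_eq_iff [simp]: "rank i = rank j \<longleftrightarrow> i = (j :: 'n::{finite,wellorder})"
  using bij_betw_imp_inj_on[OF rank_bij] by (auto simp: inj_on_def)

lemma rank_surj:
  assumes "a < CARD('n)"
  obtains i :: "'n::{finite,wellorder}" where "rank i = a"
proof -
  have "a \<in> range (rank :: 'n \<Rightarrow> nat)"
    using rank_bij[where 'n='n] assms by (simp add: bij_betw_def)
  then show thesis using that by blast
qed

lemma sum_rank: "(\<Sum>i\<in>UNIV. f (rank (i :: 'n::{finite,wellorder}))) = (\<Sum>a<CARD('n). f a)"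
  using sum.reindex_bij_betw[OF rank_bij, of f] by (simp add: atLeast0LessThan)

text \<open>Conjugation by the bijection \<open>rank\<close> carries permutations of the coordinate
  type to permutations of \<open>{0..<CARD('n)}\<close> and preserves signs, so the two Leibniz sums
  agree term by term.\<close>

lemma det_eq_det_nat:
  "det (\<chi> i j. f (rank i) (rank (j :: 'n::{finite,wellorder}))) = det_nat CARD('n) f"
proof -
  let ?r = "rank :: 'n \<Rightarrow> nat"
  let ?m = "map_permutation UNIV ?r"
  have bij: "bij_betw ?m {p. p permutes UNIV} {p. p permutes {0..<CARD('n)}}"
  proof -
    have eq: "?m = (\<lambda>p x. if x \<in> {0..<CARD('n)} then ?r (p (inv_into UNIV ?r x)) else x)"
      using rank_bij[where 'n='n]
      by (auto simp: map_permutation_def restrict_id_def bij_betw_def fun_eq_iff)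
    show ?thesis unfolding eq by (rule bij_betw_permutations[OF rank_bij])
  qed
  have inj: "inj ?r" using rank_bij bij_betw_def by blast
  have "det_nat CARD('n) f = (\<Sum>p | p permutes (UNIV :: 'n set).
      of_int (sign (?m p)) * (\<Prod>a<CARD('n). f a (?m p a)))"
    unfolding det_nat_def by (rule sum.reindex_bij_betw[OF bij, symmetric])
  also have "\<dots> = (\<Sum>p | p permutes (UNIV :: 'n set).
      of_int (sign p) * (\<Prod>i\<in>UNIV. f (rank i) (rank (p i))))"
  proof (rule sum.cong[OF refl], goal_cases)
    case (1 p)
    have "(\<Prod>a<CARD('n). f a (?m p a)) = (\<Prod>i\<in>(UNIV::'n set). f (rank i) (?m p (rank i)))"
      using prod.reindex_bij_betw[OF rank_bij[where 'n='n], of "\<lambda>a. f a (?m p a)"]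
      by (simp add: atLeast0LessThan)
    also have "\<dots> = (\<Prod>i\<in>UNIV. f (rank i) (rank (p i)))"
      by (simp add: map_permutation_apply[OF inj])
    finally show ?case
      using 1 sign_map_permutation[OF inj] by simp
  qed
  finally show ?thesis by (simp add: det_def)
qed

lemma det_nat_cong:
  assumes "\<And>a b. a < k \<Longrightarrow> b < k \<Longrightarrow> M a b = N a b"
  shows "det_nat k M = det_nat k N"
  unfolding det_nat_def
proof (intro sum.cong refl arg_cong2[where f="(*)"] prod.cong, goal_cases)
  case (1 p a)
  then have "p a < k" using permutes_in_image[of p "{0..<k}" a] by auto
  with 1 show ?case by (auto intro: assms)
qed

text \<open>Only permutations fixing \<open>k\<close> contribute, and these are the permutations of
  \<open>{0..<k}\<close>. The hypothesis speaks of permutations so that a last row and a last column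
  vanishing off the diagonal are both instances.\<close>

lemma det_nat_Suc_fixing_last:
  assumes "\<And>p. p permutes {0..<Suc k} \<Longrightarrow> p k \<noteq> k \<Longrightarrow> \<exists>a<Suc k. M a (p a) = 0"
  shows "det_nat (Suc k) M = det_nat k M * M k k"
proof -
  have "det_nat (Suc k) M
      = (\<Sum>p | p permutes {0..<k}. of_int (sign p) * (\<Prod>i<Suc k. M i (p i)))"
    unfolding det_nat_def
  proof (rule sum.mono_neutral_right)
    show "finite {p. p permutes {0..<Suc k}}" by (simp add: finite_permutations)
    show "{p. p permutes {0..<k}} \<subseteq> {p. p permutes {0..<Suc k}}"
      by (auto intro: permutes_subset)
    show "\<forall>p\<in>{p. p permutes {0..<Suc k}} - {p. p permutes {0..<k}}.
        of_int (sign p) * (\<Prod>i<Suc k. M i (p i)) = 0"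
    proof
      fix p assume p: "p \<in> {p. p permutes {0..<Suc k}} - {p. p permutes {0..<k}}"
      have "p k \<noteq> k"
      proof
        assume "p k = k"
        moreover have "x = k" if "x \<in> {0..<Suc k} - {0..<k}" for x using that by auto
        ultimately have "p permutes {0..<k}"
          using p by (intro permutes_superset[of p "{0..<Suc k}" "{0..<k}"]) blast+
        with p show False by simp
      qed
      then obtain a where "a < Suc k" "M a (p a) = 0" using p assms by blast
      then have "(\<Prod>i<Suc k. M i (p i)) = 0" by (intro prod_zero) auto
      then show "of_int (sign p) * (\<Prod>i<Suc k. M i (p i)) = 0" by (simp del: prod.lessThan_Suc)
    qed
  qed
  also have "\<dots> = (\<Sum>p | p permutes {0..<k}. of_int (sign p) * (\<Prod>i<k. M i (p i)) * M k k)"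
    by (rule sum.cong) (auto simp: permutes_not_in)
  finally show ?thesis by (simp add: det_nat_def sum_distrib_right)
qed

lemma det_nat_Suc_row:
  assumes "\<And>b. b < k \<Longrightarrow> M k b = 0"
  shows "det_nat (Suc k) M = det_nat k M * M k k"
proof (rule det_nat_Suc_fixing_last)
  fix p assume p: "p permutes {0..<Suc k}" "p k \<noteq> k"
  then have "p k < Suc k" using permutes_in_image[of p "{0..<Suc k}" k] by auto
  with p assms show "\<exists>a<Suc k. M a (p a) = 0" by (metis less_SucE lessI)
qed

lemma det_nat_Suc_col:
  assumes "\<And>a. a < k \<Longrightarrow> M a k = 0"
  shows "det_nat (Suc k) M = det_nat k M * M k k"
proof (rule det_nat_Suc_fixing_last)
  fix p assume p: "p permutes {0..<Suc k}" "p k \<noteq> k"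
  then obtain a where "p a = k" by (metis permutes_surj surjD)
  moreover have "a < Suc k"
    using permutes_in_image[OF p(1), of a] \<open>p a = k\<close> by auto
  moreover have "a \<noteq> k" using p \<open>p a = k\<close> by auto
  ultimately show "\<exists>a<Suc k. M a (p a) = 0" using assms by (metis less_SucE)
qed

section \<open>Gram matrices, orthonormal completion and linear independence\<close>

definition row_matrix :: "(nat \<Rightarrow> (real,'n::{finite,wellorder}) vec) \<Rightarrow> ((real,'n) vec,'n) vec" where
  "row_matrix d = (\<chi> i. d (rank i))"

text \<open>The table of values is the product of \<open>row_matrix s\<close>, the transpose of
  \<open>A\<close> and the transpose of \<open>row_matrix t\<close>. This splits a pairing of two
  families into ordinary determinants.\<close>

lemma det_nat_bilinear:
  fixes A :: "((real,'n::{finite,wellorder}) vec,'n) vec"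
  shows "det_nat CARD('n) (\<lambda>a b. (A *v s a) \<bullet> t b)
    = det A * det (row_matrix s) * det (row_matrix t)"
proof -
  have "(\<chi> i j. (A *v s (rank i)) \<bullet> t (rank j))
      = row_matrix s ** transpose A ** transpose (row_matrix t)"
    by (simp add: vec_eq_iff matrix_matrix_mult_def transpose_def row_matrix_def inner_vec_def
        matrix_vector_mult_def mult.commute)
  then show ?thesis
    by (simp add: det_eq_det_nat[symmetric] det_mul det_transpose)
qed

lemma det_nat_gram: "det_nat CARD('n) (\<lambda>a b. s a \<bullet> t b)
    = det (row_matrix s) * det (row_matrix (t :: nat \<Rightarrow> (real,'n::{finite,wellorder}) vec))"
  using det_nat_bilinear[of "mat 1" s t] by simp

text \<open>Downward induction on \<open>m\<close>: fewer than \<open>DIM('a)\<close> vectors leave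
  room for a unit vector orthogonal to all of them, which is stored at position \<open>m\<close>.
  The vectors \<open>c a\<close> with \<open>a < m\<close> are arbitrary, possibly
  dependent.\<close>

lemma orthonormal_extension:
  fixes c :: "nat \<Rightarrow> 'a::euclidean_space"
  assumes "m \<le> DIM('a)"
  shows "\<exists>d. (\<forall>a<m. d a = c a) \<and>
    (\<forall>a\<in>{m..<DIM('a)}. d a \<bullet> d a = 1 \<and> (\<forall>b<a. d a \<bullet> d b = 0))"
  using assms
proof (induction m arbitrary: c rule: inc_induct)
  case base
  then show ?case by auto
next
  case (step m)
  have "dim (c ` {..<m}) \<le> m"
    using dim_le_card[of "c ` {..<m}" "c ` {..<m}"] card_image_le[of "{..<m}" c]
    by (auto simp: span_superset)
  then have "dim (c ` {..<m}) < DIM('a)" using step by simp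
  then obtain x where x: "x \<noteq> 0" "\<And>y. y \<in> span (c ` {..<m}) \<Longrightarrow> orthogonal x y"
    by (rule orthogonal_to_subspace_exists) blast
  define w where "w = sgn x"
  have w: "w \<bullet> w = 1" "\<And>a. a < m \<Longrightarrow> w \<bullet> c a = 0"
    using x(1) x(2)[OF span_base]
    by (auto simp: w_def orthogonal_def norm_eq_1[symmetric] norm_sgn)
      (auto simp: sgn_div_norm)
  obtain d where d: "\<forall>a<Suc m. d a = (c(m := w)) a"
    "\<forall>a\<in>{Suc m..<DIM('a)}. d a \<bullet> d a = 1 \<and> (\<forall>b<a. d a \<bullet> d b = 0)"
    using step.IH[of "c(m := w)"] by blast
  show ?case
  proof (intro exI[of _ d] conjI allI impI ballI)
    show "d a = c a" if "a < m" for a using d(1) that by simp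
    fix a assume a: "a \<in> {m..<DIM('a)}"
    show "d a \<bullet> d a = 1" using a d w by (cases "a = m") auto
    show "d a \<bullet> d b = 0" if "b < a" for b using a d w that by (cases "a = m") auto
  qed
qed

text \<open>Each appended vector adds a last Gram row that is 0 off the diagonal and 1 on
  it.\<close>

lemma gram_extension:
  fixes d :: "nat \<Rightarrow> 'a::euclidean_space"
  assumes "m \<le> k" and "\<And>a. m \<le> a \<Longrightarrow> a < k \<Longrightarrow> d a \<bullet> d a = 1"
    and "\<And>a b. m \<le> a \<Longrightarrow> a < k \<Longrightarrow> b < a \<Longrightarrow> d a \<bullet> d b = 0"
  shows "det_nat k (\<lambda>a b. d a \<bullet> d b) = det_nat m (\<lambda>a b. d a \<bullet> d b)"
  using assms(1)
proof (induction k rule: dec_induct)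
  case (step j)
  then show ?case
    using assms det_nat_Suc_row[of j "\<lambda>a b. d a \<bullet> d b"] by simp
qed simp

text \<open>A combination of the vectors is the transposed matrix applied to the coefficient vector,
  so independence means a trivial kernel.\<close>

lemma det_row_matrix_nonzero_iff:
  fixes d :: "nat \<Rightarrow> (real,'n::{finite,wellorder}) vec"
  shows "det (row_matrix d) \<noteq> 0
    \<longleftrightarrow> (\<forall>l. (\<Sum>a<CARD('n). l a *\<^sub>R d a) = 0 \<longrightarrow> (\<forall>a<CARD('n). l a = 0))"
proof -
  have comb: "transpose (row_matrix d) *v (\<chi> i. l (rank i)) = (\<Sum>a<CARD('n). l a *\<^sub>R d a)" for l
  proof -
    have "transpose (row_matrix d) *v (\<chi> i. l (rank i))
        = (\<Sum>i\<in>(UNIV::'n set). l (rank i) *\<^sub>R d (rank i))"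
      by (simp add: vec_eq_iff matrix_vector_mult_def transpose_def row_matrix_def mult.commute)
    then show ?thesis by (simp add: sum_rank[of "\<lambda>a. l a *\<^sub>R d a"])
  qed
  have "det (row_matrix d) \<noteq> 0 \<longleftrightarrow> invertible (transpose (row_matrix d))"
    by (simp add: invertible_det_nz det_transpose)
  also have "\<dots> \<longleftrightarrow> (\<forall>x. transpose (row_matrix d) *v x = 0 \<longrightarrow> x = 0)"
    by (simp add: invertible_left_inverse matrix_left_invertible_ker)
  also have "\<dots> \<longleftrightarrow> (\<forall>l. (\<Sum>a<CARD('n). l a *\<^sub>R d a) = 0 \<longrightarrow> (\<forall>a<CARD('n). l a = 0))"
  proof safe
    fix l a assume *: "\<forall>x. transpose (row_matrix d) *v x = 0 \<longrightarrow> x = 0"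
      and "(\<Sum>a<CARD('n). l a *\<^sub>R d a) = 0" and a: "a < CARD('n)"
    then have "(\<chi> i. l (rank (i::'n))) = 0" using comb[of l] by auto
    moreover obtain i :: 'n where "rank i = a" using rank_surj[OF a] by blast
    ultimately show "l a = 0" by (auto simp: vec_eq_iff)
  next
    fix x :: "(real,'n) vec"
    assume *: "\<forall>l. (\<Sum>a<CARD('n). l a *\<^sub>R d a) = 0 \<longrightarrow> (\<forall>a<CARD('n). l a = 0)"
      and x: "transpose (row_matrix d) *v x = 0"
    define l where "l a = x $ (inv rank a)" for a
    have l: "l (rank i) = x $ i" for i :: 'n
      using bij_betw_imp_inj_on[OF rank_bij[where 'n='n]] by (simp add: l_def inv_f_f)
    then have "(\<chi> i. l (rank i)) = x" by (simp add: vec_eq_iff)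
    with comb[of l] x have "(\<Sum>a<CARD('n). l a *\<^sub>R d a) = 0" by simp
    with * have "l (rank i) = 0" for i :: 'n using rank_less by blast
    with l show "x = 0" by (simp add: vec_eq_iff)
  qed
  finally show ?thesis .
qed

text \<open>Appending orthonormal vectors keeps the Gram determinant, and for a full family of
  \<open>CARD('n)\<close> vectors it is the square of \<open>det (row_matrix d)\<close>. Questions
  about \<open>m\<close> vectors thus become questions about square matrices.\<close>

lemma gram_completion:
  fixes c :: "nat \<Rightarrow> (real,'n::{finite,wellorder}) vec"
  assumes "m \<le> CARD('n)"
  obtains d where "\<And>a. a < m \<Longrightarrow> d a = c a"
    and "\<And>a. m \<le> a \<Longrightarrow> a < CARD('n) \<Longrightarrow> d a \<bullet> d a = 1"
    and "\<And>a b. m \<le> a \<Longrightarrow> a < CARD('n) \<Longrightarrow> b < a \<Longrightarrow> d a \<bullet> d b = 0"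
    and "det_nat m (\<lambda>a b. c a \<bullet> c b) = (det (row_matrix d))\<^sup>2"
proof -
  obtain d where d: "\<forall>a<m. d a = c a"
    "\<forall>a\<in>{m..<CARD('n)}. d a \<bullet> d a = 1 \<and> (\<forall>b<a. d a \<bullet> d b = 0)"
    using orthonormal_extension[of m c] assms by auto
  have "det_nat m (\<lambda>a b. c a \<bullet> c b) = det_nat m (\<lambda>a b. d a \<bullet> d b)"
    using d(1) by (intro det_nat_cong) simp
  also have "\<dots> = det_nat CARD('n) (\<lambda>a b. d a \<bullet> d b)"
    by (rule gram_extension[symmetric]) (use assms d(2) in auto)
  also have "\<dots> = (det (row_matrix d))\<^sup>2"
    by (simp add: det_nat_gram power2_eq_square)
  finally show thesis using d by (intro that) auto
qed

text \<open>Padded with zero coefficients, the relation becomes one among the rows of the completed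
  matrix, which is nonsingular.\<close>

lemma gram_independent:
  fixes c :: "nat \<Rightarrow> (real,'n::{finite,wellorder}) vec"
  assumes "m \<le> CARD('n)" and "det_nat m (\<lambda>a b. c a \<bullet> c b) \<noteq> 0"
    and "(\<Sum>a<m. l a *\<^sub>R c a) = 0" and "a < m"
  shows "l a = 0"
proof -
  obtain d where d: "\<And>a. a < m \<Longrightarrow> d a = c a"
    "det_nat m (\<lambda>a b. c a \<bullet> c b) = (det (row_matrix d))\<^sup>2"
    using gram_completion[OF assms(1), of c] by metis
  define l' where "l' a = (if a < m then l a else 0)" for a
  have "(\<Sum>a<CARD('n). l' a *\<^sub>R d a) = (\<Sum>a<m. l' a *\<^sub>R d a)"
    by (rule sum.mono_neutral_right) (use assms(1) in \<open>auto simp: l'_def\<close>)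
  also have "\<dots> = (\<Sum>a<m. l a *\<^sub>R c a)"
    by (rule sum.cong) (auto simp: l'_def d)
  finally have "(\<Sum>a<CARD('n). l' a *\<^sub>R d a) = 0" using assms(3) by simp
  moreover have "det (row_matrix d) \<noteq> 0" using assms(2) d(2) by simp
  ultimately have "l' a = 0"
    using det_row_matrix_nonzero_iff[of d] assms(1,4) by (meson less_le_trans)
  then show ?thesis using assms(4) by (simp add: l'_def)
qed

text \<open>Completing the first \<open>Suc m\<close> vectors gives a singular matrix, hence a
  nontrivial relation. The appended vectors drop out of it, and independence of the first
  \<open>m\<close> vectors makes the coefficient of \<open>c m\<close> nonzero, so one can divide by
  it.\<close>

lemma gram_dependent:
  fixes c :: "nat \<Rightarrow> (real,'n::{finite,wellorder}) vec"
  assumes m: "Suc m \<le> CARD('n)" and nz: "det_nat m (\<lambda>a b. c a \<bullet> c b) \<noteq> 0"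
    and z: "det_nat (Suc m) (\<lambda>a b. c a \<bullet> c b) = 0"
  shows "\<exists>l. c m + (\<Sum>a<m. l a *\<^sub>R c a) = 0"
proof -
  obtain d where d: "\<And>a. a < Suc m \<Longrightarrow> d a = c a"
    and d1: "\<And>a. Suc m \<le> a \<Longrightarrow> a < CARD('n) \<Longrightarrow> d a \<bullet> d a = 1"
    and d0: "\<And>a b. Suc m \<le> a \<Longrightarrow> a < CARD('n) \<Longrightarrow> b < a \<Longrightarrow> d a \<bullet> d b = 0"
    and "det_nat (Suc m) (\<lambda>a b. c a \<bullet> c b) = (det (row_matrix d))\<^sup>2"
    by (rule gram_completion[OF m, of c]) blast
  with z have "det (row_matrix d) = 0" by simp
  then obtain l e where l: "(\<Sum>a<CARD('n). l a *\<^sub>R d a) = 0" and e: "e < CARD('n)" "l e \<noteq> 0"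
    using det_row_matrix_nonzero_iff[of d] by blast
  \<comment> \<open>Pairing the relation with the appended vector \<open>d a\<close> isolates
    \<open>l a\<close>.\<close>
  have tail: "l a = 0" if a: "Suc m \<le> a" "a < CARD('n)" for a
  proof -
    have "d a \<bullet> d b = (if b = a then 1 else 0)" if "b < CARD('n)" for b
      using that a d0[of a b] d0[of b a] d1[of a]
      by (cases "b < a"; cases "b = a") (auto simp: inner_commute)
    then have "(\<Sum>b<CARD('n). d a \<bullet> (l b *\<^sub>R d b)) = (\<Sum>b<CARD('n). if b = a then l b else 0)"
      by (intro sum.cong) auto
    then have "d a \<bullet> (\<Sum>b<CARD('n). l b *\<^sub>R d b) = l a"
      using a by (simp add: inner_sum_right)
    then show ?thesis using l by simp
  qed
  have "(\<Sum>a<CARD('n). l a *\<^sub>R d a) = (\<Sum>a<Suc m. l a *\<^sub>R d a)"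
    by (rule sum.mono_neutral_right) (use m tail in \<open>auto simp: not_less\<close>)
  also have "\<dots> = (\<Sum>a<Suc m. l a *\<^sub>R c a)"
    using d by (intro sum.cong) auto
  finally have sum0: "(\<Sum>a<m. l a *\<^sub>R c a) + l m *\<^sub>R c m = 0" using l by simp
  have "l m \<noteq> 0"
  proof
    assume "l m = 0"
    then have "l a = 0" if "a < m" for a
      using gram_independent[of m c l, OF _ nz _ that] m sum0 by simp
    with tail e \<open>l m = 0\<close> show False by (metis linorder_neqE_nat not_less_eq_eq not_less)
  qed
  have "c m + (\<Sum>a<m. (l a / l m) *\<^sub>R c a) = (1 / l m) *\<^sub>R ((\<Sum>a<m. l a *\<^sub>R c a) + l m *\<^sub>R c m)"
    using \<open>l m \<noteq> 0\<close> by (simp add: scaleR_add_right scaleR_sum_right)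
  then show ?thesis using sum0 by (metis scaleR_zero_right)
qed

text \<open>With \<open>v\<close> completing \<open>u\<close> to an orthonormal basis of the orthogonal complement of the
  \<open>c a\<close>, the claim comes from pairing the rows \<open>A\<inverse> c\<^sub>0, \<dots>, A\<inverse> c\<^sub>m\<^sub>-\<^sub>1, u, u - v\<close> with the rows
  \<open>c\<^sub>0, \<dots>, c\<^sub>m\<^sub>-\<^sub>1, u + v, u\<close>: both the inner product and the form of \<open>A\<close> then have block
  triangular matrices.\<close>
lemma no_isotropic_vector:
  fixes A :: "((real,'n::{finite,wellorder}) vec,'n) vec"
    and c :: "nat \<Rightarrow> (real,'n) vec"
  assumes m: "m + 2 = CARD('n)" and inv: "invertible A"
    and sym: "\<And>x y. (A *v x) \<bullet> y = (A *v y) \<bullet> x"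
    and pos: "det A * det_nat m (\<lambda>a b. (matrix_inv A *v c a) \<bullet> c b) > 0"
    and u: "u \<noteq> 0" "\<And>a. a < m \<Longrightarrow> u \<bullet> c a = 0"
  shows "(A *v u) \<bullet> u \<noteq> 0"
proof
  assume "(A *v u) \<bullet> u = 0"
  define w where "w = sgn u"
  have w: "w \<bullet> w = 1" "\<And>a. a < m \<Longrightarrow> w \<bullet> c a = 0" "(A *v w) \<bullet> w = 0"
    using u \<open>(A *v u) \<bullet> u = 0\<close>
    by (auto simp: w_def norm_eq_1[symmetric] norm_sgn)
      (auto simp: sgn_div_norm matrix_vector_mult_scaleR)
  have "Suc m \<le> CARD('n)" using m by simp
  then obtain d where d: "\<forall>a<Suc m. d a = (c(m := w)) a"
    "\<forall>a\<in>{Suc m..<CARD('n)}. d a \<bullet> d a = 1 \<and> (\<forall>b<a. d a \<bullet> d b = 0)"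
    using orthonormal_extension[of "Suc m" "c(m := w)"] by auto
  \<comment> \<open>The unit vector \<open>w\<close> occupies position \<open>m\<close>, so exactly
    one appended vector remains; it is orthogonal to \<open>w\<close> and to every
    \<open>c a\<close>.\<close>
  define v where "v = d (Suc m)"
  have v: "v \<bullet> v = 1" "\<And>a. a < m \<Longrightarrow> v \<bullet> c a = 0" "v \<bullet> w = 0"
  proof -
    have Sm: "Suc m \<in> {Suc m..<CARD('n)}" using m by auto
    then show "v \<bullet> v = 1" using d by (auto simp: v_def)
    show "v \<bullet> c a = 0" if "a < m" for a
      using bspec[OF d(2) Sm] d(1) that unfolding v_def by (metis fun_upd_apply less_SucI less_irrefl)
    show "v \<bullet> w = 0"
      using bspec[OF d(2) Sm] d(1) unfolding v_def by (metis fun_upd_same lessI)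
  qed
  have n: "CARD('n) = Suc (Suc m)" using m by simp
  have AA: "A *v (matrix_inv A *v x) = x" for x
  proof -
    have "A ** matrix_inv A = mat 1"
      using inv unfolding invertible_def matrix_inv_def by (rule someI2_ex) simp
    then show ?thesis by (simp add: matrix_vector_mul_assoc)
  qed
  \<comment> \<open>Since \<open>w\<close> and \<open>v\<close> are orthonormal,
    \<open>w - v\<close> is orthogonal to \<open>w + v\<close>, while
    \<open>w \<bullet> (w + v)\<close> and \<open>(w - v) \<bullet> w\<close> equal 1. The last two
    diagonal entries of the inner product table are therefore 1 and only the \<open>m\<close> by
    \<open>m\<close> block remains.\<close>
  define s where "s a = (if a < m then matrix_inv A *v c a else if a = m then w else w - v)" for a
  define t where "t a = (if a < m then c a else if a = m then w + v else w)" for a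
  have "det_nat CARD('n) (\<lambda>a b. s a \<bullet> t b)
      = det_nat (Suc m) (\<lambda>a b. s a \<bullet> t b) * (s (Suc m) \<bullet> t (Suc m))"
    unfolding n
    by (rule det_nat_Suc_row)
      (use w v in \<open>auto simp: s_def t_def less_Suc_eq inner_simps inner_commute\<close>)
  also have "det_nat (Suc m) (\<lambda>a b. s a \<bullet> t b) = det_nat m (\<lambda>a b. s a \<bullet> t b) * (s m \<bullet> t m)"
    by (rule det_nat_Suc_row) (use w v in \<open>auto simp: s_def t_def\<close>)
  also have "det_nat m (\<lambda>a b. s a \<bullet> t b) = det_nat m (\<lambda>a b. (matrix_inv A *v c a) \<bullet> c b)"
    by (rule det_nat_cong) (auto simp: s_def t_def)
  also have "s m \<bullet> t m = 1" using w v by (simp add: s_def t_def inner_simps inner_commute)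
  also have "s (Suc m) \<bullet> t (Suc m) = 1" using w v by (simp add: s_def t_def inner_simps)
  finally have I: "det (row_matrix s) * det (row_matrix t)
      = det_nat m (\<lambda>a b. (matrix_inv A *v c a) \<bullet> c b)"
    by (simp add: det_nat_gram)
  \<comment> \<open>Here the last two columns vanish above the diagonal: \<open>A\<close> maps the
    first rows back to the \<open>c a\<close>, which are orthogonal to \<open>w\<close> and
    \<open>v\<close>, and the remaining entry \<open>(A *v w) \<bullet> w\<close> is zero by
    isotropy.\<close>
  have "det_nat CARD('n) (\<lambda>a b. (A *v s a) \<bullet> t b)
      = det_nat (Suc m) (\<lambda>a b. (A *v s a) \<bullet> t b) * ((A *v s (Suc m)) \<bullet> t (Suc m))"
    unfolding n
    by (rule det_nat_Suc_col)
      (use w in \<open>auto simp: s_def t_def less_Suc_eq AA inner_commute\<close>)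
  also have "det_nat (Suc m) (\<lambda>a b. (A *v s a) \<bullet> t b)
      = det_nat m (\<lambda>a b. (A *v s a) \<bullet> t b) * ((A *v s m) \<bullet> t m)"
    by (rule det_nat_Suc_col)
      (use w v in \<open>auto simp: s_def t_def AA inner_simps inner_commute\<close>)
  also have "det_nat m (\<lambda>a b. (A *v s a) \<bullet> t b) = det_nat m (\<lambda>a b. c a \<bullet> c b)"
    by (rule det_nat_cong) (auto simp: s_def t_def AA)
  also have "(A *v s m) \<bullet> t m = (A *v w) \<bullet> v" using w by (simp add: s_def t_def inner_simps)
  also have "(A *v s (Suc m)) \<bullet> t (Suc m) = - ((A *v w) \<bullet> v)"
    using w sym[of v w] by (simp add: s_def t_def inner_simps matrix_vector_mult_diff_distrib)
  \<comment> \<open>On the plane of \<open>w\<close> and \<open>v\<close> a form vanishing at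
    \<open>w\<close> has determinant minus the square of its mixed entry. As the Gram determinant of
    the \<open>c a\<close> is a square, the product cannot be positive.\<close>
  finally have "det A * det_nat m (\<lambda>a b. (matrix_inv A *v c a) \<bullet> c b)
      = - (det_nat m (\<lambda>a b. c a \<bullet> c b) * ((A *v w) \<bullet> v)\<^sup>2)"
    by (simp add: det_nat_bilinear mult.assoc I power2_eq_square)
  moreover have "m \<le> CARD('n)" using m by simp
  from gram_completion[OF this, of c] have "det_nat m (\<lambda>a b. c a \<bullet> c b) \<ge> 0"
    by (metis zero_le_power2)
  ultimately show False using pos by (simp add: mult_nonneg_nonneg leD)
qed

section \<open>Smooth functions and Hessians\<close>

lemma has_derivative_grad:
  assumes "f differentiable (at x)"
  shows "(f has_derivative (\<lambda>h. grad f x \<bullet> h)) (at x)"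
proof -
  let ?D = "frechet_derivative f (at x)"
  have D: "(f has_derivative ?D) (at x)" using assms by (simp add: frechet_derivative_works)
  then interpret linear ?D by (rule has_derivative_linear)
  have "?D h = grad f x \<bullet> h" for h
  proof -
    have "?D h = ?D (\<Sum>j\<in>UNIV. h $ j *\<^sub>R axis j 1)"
      using basis_expansion[of h] by (simp add: scalar_mult_eq_scaleR)
    also have "\<dots> = (\<Sum>j\<in>UNIV. h $ j * ?D (axis j 1))" by (simp add: sum scaleR)
    also have "\<dots> = grad f x \<bullet> h"
      by (simp add: grad_def pd_def inner_vec_def mult.commute)
    finally show ?thesis .
  qed
  then have "?D = (\<lambda>h. grad f x \<bullet> h)" by blast
  with D show ?thesis by simp
qed

lemma grad_eqI:
  assumes "(f has_derivative (\<lambda>h. v \<bullet> h)) (at x)"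
  shows "grad f x = v"
proof -
  have "frechet_derivative f (at x) = (\<lambda>h. v \<bullet> h)"
    using frechet_derivative_at[OF assms] by simp
  then show ?thesis by (simp add: grad_def pd_def vec_eq_iff inner_axis)
qed

lemma grad_inner_axis: "grad f x \<bullet> axis j 1 = pd j f x"
  by (simp add: grad_def inner_axis)

lemma DERIV_along_line:
  assumes "f differentiable (at (c + t *\<^sub>R e))"
  shows "((\<lambda>t. f (c + t *\<^sub>R e)) has_real_derivative grad f (c + t *\<^sub>R e) \<bullet> e) (at t)"
proof -
  have "((\<lambda>t. c + t *\<^sub>R e) has_derivative (\<lambda>s. s *\<^sub>R e)) (at t)"
    by (auto intro!: derivative_eq_intros)
  from diff_chain_at[OF this has_derivative_grad[OF assms]]
  have "((\<lambda>t. f (c + t *\<^sub>R e)) has_derivative (\<lambda>s. s * (grad f (c + t *\<^sub>R e) \<bullet> e))) (at t)"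
    by (simp add: o_def)
  then show ?thesis by (rule has_derivative_imp_has_field_derivative) simp
qed

text \<open>\<open>frechet_derivative\<close> is a choice among all derivatives at the point.
  Functions agreeing on an open neighbourhood have the same candidates, so the choices coincide even
  where there is no derivative.\<close>

lemma pd_cong_open:
  assumes "open \<Omega>" "x \<in> \<Omega>" "\<And>y. y \<in> \<Omega> \<Longrightarrow> f y = g y"
  shows "pd j f x = pd j g x"
proof -
  have "(f has_derivative D) (at x) \<longleftrightarrow> (g has_derivative D) (at x)" for D
    using has_derivative_transform_within_open[OF _ assms(1,2), of f D UNIV g]
      has_derivative_transform_within_open[OF _ assms(1,2), of g D UNIV f] assms(3) by auto
  then show ?thesis by (simp add: pd_def frechet_derivative_def)
qed

lemma pd_linear:
  assumes "f differentiable (at x)" "g differentiable (at x)"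
  shows "pd j (\<lambda>x. f x + a * g x) x = pd j f x + a * pd j g x"
proof -
  have "grad (\<lambda>x. f x + a * g x) x = grad f x + a *\<^sub>R grad g x"
    by (rule grad_eqI)
      (auto intro!: derivative_eq_intros has_derivative_grad assms simp: inner_simps)
  then show ?thesis by (simp add: grad_def vec_eq_iff)
qed

lemma CinfD:
  assumes "Cinf \<Omega> f" "open \<Omega>" "x \<in> \<Omega>"
  shows "foldr pd js f differentiable (at x)"
  using assms by (metis Cinf_def differentiable_on_def at_within_open)

lemma CinfD0: "Cinf \<Omega> f \<Longrightarrow> open \<Omega> \<Longrightarrow> x \<in> \<Omega> \<Longrightarrow> f differentiable (at x)"
  using CinfD[of \<Omega> f x "[]"] by simp

lemma CinfD1: "Cinf \<Omega> f \<Longrightarrow> open \<Omega> \<Longrightarrow> x \<in> \<Omega> \<Longrightarrow> pd j f differentiable (at x)"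
  using CinfD[of \<Omega> f x "[j]"] by simp

lemma Cinf_pd:
  assumes "Cinf \<Omega> f" shows "Cinf \<Omega> (pd j f)"
  unfolding Cinf_def
proof
  fix js
  show "foldr pd js (pd j f) differentiable_on \<Omega>"
    using assms[unfolded Cinf_def, rule_format, of "js @ [j]"] by simp
qed

lemma Cinf_linear:
  assumes "open \<Omega>" "Cinf \<Omega> f" "Cinf \<Omega> g"
  shows "Cinf \<Omega> (\<lambda>x. f x + a * g x)"
proof -
  let ?h = "\<lambda>x. f x + a * g x"
  \<comment> \<open>Linearity of the iterated derivatives is known only on \<open>\<Omega>\<close>;
    its openness lets the equality pass through one more \<open>pd\<close>.\<close>
  have eq: "\<forall>x\<in>\<Omega>. foldr pd js ?h x = foldr pd js f x + a * foldr pd js g x" for js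
  proof (induction js)
    case (Cons j js)
    show ?case
    proof
      fix x assume x: "x \<in> \<Omega>"
      have "pd j (foldr pd js ?h) x = pd j (\<lambda>x. foldr pd js f x + a * foldr pd js g x) x"
        by (rule pd_cong_open[OF assms(1) x]) (use Cons in blast)
      also have "\<dots> = pd j (foldr pd js f) x + a * pd j (foldr pd js g) x"
        by (intro pd_linear CinfD[OF _ assms(1) x] assms)
      finally show "foldr pd (j # js) ?h x = foldr pd (j # js) f x + a * foldr pd (j # js) g x"
        by simp
    qed
  qed simp
  show ?thesis
    unfolding Cinf_def
  proof
    fix js
    have "(\<lambda>x. foldr pd js f x + a * foldr pd js g x) differentiable_on \<Omega>"
      using assms unfolding Cinf_def by (intro derivative_intros) auto
    then show "foldr pd js ?h differentiable_on \<Omega>"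
      unfolding differentiable_on_def
      by (metis (no_types, lifting) differentiable_transform_within eq zero_less_one)
  qed
qed

lemma Cinf_linear_combination:
  assumes "open \<Omega>" "Cinf \<Omega> f" "finite K" "\<And>k. k \<in> K \<Longrightarrow> Cinf \<Omega> (g k)"
  shows "Cinf \<Omega> (\<lambda>x. f x + (\<Sum>k\<in>K. a k * g k x))"
  using assms(3,4)
proof (induction K rule: finite_induct)
  case empty
  then show ?case using assms(2) by simp
next
  case (insert k K)
  have "Cinf \<Omega> (\<lambda>x. (f x + (\<Sum>k\<in>K. a k * g k x)) + a k * g k x)"
    using insert by (intro Cinf_linear assms(1)) auto
  then show ?case using insert by (simp add: algebra_simps)
qed

section \<open>Symmetry of second derivatives\<close>

text \<open>The mean value theorem in direction \<open>e\<close> turns the second difference into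
  \<open>s\<close> times an increment of \<open>pd i f\<close> in direction \<open>d\<close>.
  Differentiability of \<open>pd i f\<close> at \<open>x\<close> then expands this increment to
  first order.\<close>

lemma second_difference_tendsto:
  fixes f :: "real^'n \<Rightarrow> real" and i j :: 'n
  assumes "open \<Omega>" "x \<in> \<Omega>" "\<And>y. y \<in> \<Omega> \<Longrightarrow> f differentiable (at y)"
    and "pd i f differentiable (at x)"
  defines "e \<equiv> axis i 1" and "d \<equiv> axis j 1"
  shows "((\<lambda>s. (f (x + s *\<^sub>R e + s *\<^sub>R d) - f (x + s *\<^sub>R e) - f (x + s *\<^sub>R d) + f x) / s\<^sup>2)
    \<longlongrightarrow> pd j (pd i f) x) (at_right 0)"
proof (rule tendstoI)
  fix \<epsilon> :: real assume "\<epsilon> > 0"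
  let ?g = "pd i f" and ?D = "\<lambda>h. grad (pd i f) x \<bullet> h"
  have "(?g has_derivative ?D) (at x)" by (rule has_derivative_grad) fact
  \<comment> \<open>The two remainders are at most \<open>\<epsilon> / 6 * (\<theta> + s)\<close>
    and \<open>\<epsilon> / 6 * \<theta>\<close>; as \<open>\<theta> < s\<close>, they add up to
    less than \<open>\<epsilon> * s\<close>.\<close>
  then obtain \<delta> where \<delta>: "\<delta> > 0"
    "\<And>y. norm (y - x) < \<delta> \<Longrightarrow> \<bar>?g y - ?g x - ?D (y - x)\<bar> \<le> \<epsilon> / 6 * norm (y - x)"
    using \<open>\<epsilon> > 0\<close> unfolding has_derivative_at_alt by (auto dest!: spec[of _ "\<epsilon> / 6"])
  obtain r where r: "r > 0" "ball x r \<subseteq> \<Omega>" using assms(1,2) open_contains_ball by blast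
  \<comment> \<open>With both coefficients at most \<open>s\<close>, a displacement has norm at most
    \<open>2 * s\<close>, hence the bound \<open>s < min \<delta> r / 2\<close> below.\<close>
  have norm_ed: "norm (a *\<^sub>R e + b *\<^sub>R d) \<le> \<bar>a\<bar> + \<bar>b\<bar>" for a b
    using norm_triangle_ineq[of "a *\<^sub>R e" "b *\<^sub>R d"] by (simp add: e_def d_def)
  have main: "\<bar>(f (x + s *\<^sub>R e + s *\<^sub>R d) - f (x + s *\<^sub>R e) - f (x + s *\<^sub>R d) + f x) / s\<^sup>2
      - pd j (pd i f) x\<bar> < \<epsilon>" if s: "0 < s" "s < min \<delta> r / 2" for s
  proof -
    have in\<Omega>: "x + a *\<^sub>R e + b *\<^sub>R d \<in> \<Omega>" if "0 \<le> a" "a \<le> s" "0 \<le> b" "b \<le> s" for a b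
    proof -
      have "norm (a *\<^sub>R e + b *\<^sub>R d) < r" using norm_ed[of a b] that s by simp
      then have "x + (a *\<^sub>R e + b *\<^sub>R d) \<in> ball x r"
        by (metis add_diff_cancel_left' dist_norm dist_commute mem_ball)
      with r show ?thesis by (auto simp: add.assoc)
    qed
    define G where "G t = f (x + s *\<^sub>R d + t *\<^sub>R e) - f (x + t *\<^sub>R e)" for t
    have "DERIV G t :> ?g (x + s *\<^sub>R d + t *\<^sub>R e) - ?g (x + t *\<^sub>R e)" if "0 \<le> t" "t \<le> s" for t
      unfolding G_def e_def
      unfolding grad_inner_axis[symmetric]
      by (intro DERIV_diff DERIV_along_line assms(3); unfold e_def[symmetric])
        (use in\<Omega>[of t s] in\<Omega>[of t 0] that s in \<open>auto simp: algebra_simps\<close>)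
    then obtain \<theta> where \<theta>: "0 < \<theta>" "\<theta> < s"
      "G s - G 0 = (s - 0) * (?g (x + s *\<^sub>R d + \<theta> *\<^sub>R e) - ?g (x + \<theta> *\<^sub>R e))"
      using MVT2[OF s(1), of G "\<lambda>t. ?g (x + s *\<^sub>R d + t *\<^sub>R e) - ?g (x + t *\<^sub>R e)"] by blast
    define E where "E k = ?g (x + k) - ?g x - ?D k" for k
    have E: "\<bar>E (a *\<^sub>R e + b *\<^sub>R d)\<bar> \<le> \<epsilon> / 6 * (a + b)" if "0 \<le> a" "a \<le> s" "0 \<le> b" "b \<le> s" for a b
    proof -
      have "norm (a *\<^sub>R e + b *\<^sub>R d) < \<delta>" using norm_ed[of a b] that s by simp
      then have "\<bar>E (a *\<^sub>R e + b *\<^sub>R d)\<bar> \<le> \<epsilon> / 6 * norm (a *\<^sub>R e + b *\<^sub>R d)"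
        using \<delta>(2)[of "x + (a *\<^sub>R e + b *\<^sub>R d)"] by (simp add: E_def)
      also have "\<dots> \<le> \<epsilon> / 6 * (a + b)"
        using norm_ed[of a b] that \<open>\<epsilon> > 0\<close> by (intro mult_left_mono) auto
      finally show ?thesis .
    qed
    have "?g (x + s *\<^sub>R d + \<theta> *\<^sub>R e) - ?g (x + \<theta> *\<^sub>R e)
        = s * pd j ?g x + (E (\<theta> *\<^sub>R e + s *\<^sub>R d) - E (\<theta> *\<^sub>R e + 0 *\<^sub>R d))"
      by (simp add: E_def inner_simps algebra_simps grad_inner_axis[symmetric] d_def)
    moreover have "\<bar>E (\<theta> *\<^sub>R e + s *\<^sub>R d) - E (\<theta> *\<^sub>R e + 0 *\<^sub>R d)\<bar> \<le> \<epsilon> / 6 * (\<theta> + s) + \<epsilon> / 6 * (\<theta> + 0)"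
      using E[of \<theta> s] E[of \<theta> 0] \<theta> s by linarith
    moreover have "\<epsilon> / 6 * (\<theta> + s) + \<epsilon> / 6 * (\<theta> + 0) < \<epsilon> * s"
    proof -
      have "\<epsilon> * \<theta> < \<epsilon> * s" "0 < \<epsilon> * s" using \<theta> \<open>\<epsilon> > 0\<close> s by simp_all
      then have "\<epsilon> * \<theta> / 6 + \<epsilon> * s / 6 + \<epsilon> * \<theta> / 6 < \<epsilon> * s" by linarith
      then show ?thesis by (simp add: distrib_left)
    qed
    ultimately have "\<bar>(G s - G 0) / s - s * pd j ?g x\<bar> < \<epsilon> * s" using \<theta> s by simp
    moreover have "(G s - G 0) / s\<^sup>2 - pd j ?g x = ((G s - G 0) / s - s * pd j ?g x) / s"
      using s by (simp add: field_simps power2_eq_square)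
    ultimately have "\<bar>(G s - G 0) / s\<^sup>2 - pd j ?g x\<bar> < \<epsilon>"
      using s by (simp add: abs_divide divide_less_eq)
    then show ?thesis by (simp add: G_def algebra_simps)
  qed
  show "\<forall>\<^sub>F s in at_right 0. dist ((f (x + s *\<^sub>R e + s *\<^sub>R d) - f (x + s *\<^sub>R e)
      - f (x + s *\<^sub>R d) + f x) / s\<^sup>2) (pd j (pd i f) x) < \<epsilon>"
    unfolding eventually_at_right_field
    by (rule exI[of _ "min \<delta> r / 2"]) (use main \<delta> r in \<open>auto simp: dist_real_def\<close>)
qed

text \<open>Both mixed derivatives are limits of the same second difference quotient, which is
  symmetric in the two directions.\<close>

lemma pd_commute:
  fixes f :: "real^'n \<Rightarrow> real"
  assumes "open \<Omega>" "x \<in> \<Omega>" "\<And>y. y \<in> \<Omega> \<Longrightarrow> f differentiable (at y)"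
    and "pd i f differentiable (at x)" "pd j f differentiable (at x)"
  shows "pd j (pd i f) x = pd i (pd j f) x"
  using second_difference_tendsto[OF assms(1-4), of j]
    second_difference_tendsto[OF assms(1-3,5), of i]
  by (intro tendsto_unique[of "at_right (0::real)"]) (auto simp: algebra_simps)

lemma hess_symmetric:
  fixes f :: "real^'n \<Rightarrow> real"
  assumes "open \<Omega>" "x \<in> \<Omega>" "Cinf \<Omega> f"
  shows "(hess f x *v v) \<bullet> w = (hess f x *v w) \<bullet> v"
proof -
  have "hess f x $ i $ j = hess f x $ j $ i" for i j
    unfolding hess_def using assms
    by (simp add: pd_commute[OF assms(1,2), of f i j] CinfD0 CinfD1)
  then have "transpose (hess f x) = hess f x" by (simp add: transpose_def vec_eq_iff)
  then show ?thesis
    by (metis dot_lmul_matrix inner_commute transpose_matrix_vector)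
qed

lemma has_derivative_grad_hess:
  fixes f :: "real^'n \<Rightarrow> real"
  assumes "\<And>i. pd i f differentiable (at x)"
  shows "(grad f has_derivative (\<lambda>h. hess f x *v h)) (at x)"
proof -
  have "((\<lambda>y. grad f y \<bullet> b) has_derivative (\<lambda>h. (hess f x *v h) \<bullet> b)) (at x)" if b: "b \<in> Basis" for b
  proof -
    obtain i where i: "b = axis i 1" using b by (auto simp: Basis_vec_def)
    have "(\<lambda>h. (hess f x *v h) \<bullet> b) = (\<lambda>h. grad (pd i f) x \<bullet> h)"
      by (simp add: i inner_axis fun_eq_iff)
        (simp add: hess_def grad_def matrix_vector_mult_def inner_vec_def)
    then show ?thesis using has_derivative_grad[OF assms, of i] by (simp add: i grad_inner_axis)
  qed
  then show ?thesis by (subst has_derivative_componentwise_within) simp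
qed

section \<open>Isolated common zeros by limiting directions\<close>

text \<open>The remainder of the first-order expansion vanishes after division by the distance, and
  \<open>D\<close> is continuous along the converging unit directions.\<close>

lemma directional_limit:
  fixes g :: "'a::real_normed_vector \<Rightarrow> 'b::real_normed_vector"
  assumes "(g has_derivative D) (at a)" and "x \<longlonglongrightarrow> a" "\<And>m. x m \<noteq> a"
    and "(\<lambda>m. sgn (x m - a)) \<longlonglongrightarrow> u"
  shows "(\<lambda>m. (g (x m) - g a) /\<^sub>R norm (x m - a)) \<longlonglongrightarrow> D u"
proof -
  interpret bounded_linear D using assms(1) by (rule has_derivative_bounded_linear)
  have "filterlim x (at a) sequentially"
    using assms(2,3) by (simp add: filterlim_at)
  moreover have "((\<lambda>y. (g y - g a - D (y - a)) /\<^sub>R norm (y - a)) \<longlongrightarrow> 0) (at a)"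
    using assms(1) by (simp add: has_derivative_at_within)
  ultimately have "(\<lambda>m. (g (x m) - g a - D (x m - a)) /\<^sub>R norm (x m - a)) \<longlonglongrightarrow> 0"
    by (rule filterlim_compose[rotated])
  moreover have "(\<lambda>m. D (sgn (x m - a))) \<longlonglongrightarrow> D u"
    by (rule tendsto) fact
  ultimately have "(\<lambda>m. (g (x m) - g a - D (x m - a)) /\<^sub>R norm (x m - a) + D (sgn (x m - a)))
      \<longlonglongrightarrow> 0 + D u"
    by (rule tendsto_add)
  moreover have "(g (x m) - g a - D (x m - a)) /\<^sub>R norm (x m - a) + D (sgn (x m - a))
      = (g (x m) - g a) /\<^sub>R norm (x m - a)" for m
    unfolding sgn_div_norm scaleR by (simp flip: scaleR_add_right)
  ultimately show ?thesis by simp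
qed

text \<open>The second-order condition comes from Rolle's theorem on the segment from
  \<open>xe\<close> to a zero: at an intermediate point \<open>grad F\<close> is orthogonal to the
  segment. Since \<open>grad F xe = 0\<close>, dividing by the distance and passing to the limit
  yields the Hessian form at \<open>u\<close>.\<close>

lemma isolated_common_zero:
  fixes F :: "real^'n \<Rightarrow> real" and C :: "'k \<Rightarrow> real^'n \<Rightarrow> real"
  assumes "open \<Omega>" "xe \<in> \<Omega>" and C: "\<And>k. k \<in> K \<Longrightarrow> C k differentiable (at xe)"
    and F: "\<And>x. x \<in> \<Omega> \<Longrightarrow> F differentiable (at x)" "\<And>i. pd i F differentiable (at xe)"
      "grad F xe = 0"
    and def: "\<And>u. u \<noteq> 0 \<Longrightarrow> (\<And>k. k \<in> K \<Longrightarrow> grad (C k) xe \<bullet> u = 0) \<Longrightarrow> (hess F xe *v u) \<bullet> u \<noteq> 0"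
  shows "\<exists>r>0. cball xe r \<subseteq> \<Omega> \<and>
    (\<forall>x\<in>cball xe r. F x = F xe \<longrightarrow> (\<forall>k\<in>K. C k x = C k xe) \<longrightarrow> x = xe)"
proof (rule ccontr)
  assume neg: "\<not> ?thesis"
  obtain R where R: "R > 0" "cball xe R \<subseteq> \<Omega>" using assms(1,2) open_contains_cball by blast
  have "\<exists>x. x \<in> cball xe (R / Suc m) \<and> F x = F xe \<and> (\<forall>k\<in>K. C k x = C k xe) \<and> x \<noteq> xe" for m
  proof -
    have "R / Suc m \<le> R" using R by (simp add: divide_le_eq)
    then have "cball xe (R / Suc m) \<subseteq> \<Omega>" using R(2) subset_cball by blast
    moreover have "R / Suc m > 0" using R by simp
    ultimately show ?thesis using neg by blast
  qed
  then obtain x where x: "\<And>m. x m \<in> cball xe (R / Suc m)" "\<And>m. F (x m) = F xe"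
    "\<And>m k. k \<in> K \<Longrightarrow> C k (x m) = C k xe" "\<And>m. x m \<noteq> xe"
    by metis
  have "\<exists>\<theta>. 0 < \<theta> \<and> \<theta> < 1 \<and> grad F (xe + \<theta> *\<^sub>R (x m - xe)) \<bullet> (x m - xe) = 0" for m
  proof -
    let ?h = "x m - xe"
    have "DERIV (\<lambda>t. F (xe + t *\<^sub>R ?h)) t :> grad F (xe + t *\<^sub>R ?h) \<bullet> ?h" if "0 \<le> t" "t \<le> 1" for t
    proof (intro DERIV_along_line F(1) subsetD[OF R(2)])
      have "norm (t *\<^sub>R ?h) \<le> 1 * norm ?h"
        unfolding norm_scaleR using that by (intro mult_right_mono) auto
      also have "\<dots> \<le> R / Suc m" using x(1)[of m] by (simp add: dist_norm norm_minus_commute)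
      also have "\<dots> \<le> R" using R by (simp add: divide_le_eq)
      finally show "xe + t *\<^sub>R ?h \<in> cball xe R" by (simp add: dist_norm)
    qed
    from MVT2[OF zero_less_one this] x(2)[of m] show ?thesis by auto
  qed
  then obtain \<theta> where \<theta>: "\<And>m. 0 < \<theta> m" "\<And>m. \<theta> m < 1"
    "\<And>m. grad F (xe + \<theta> m *\<^sub>R (x m - xe)) \<bullet> (x m - xe) = 0"
    by metis
  have "\<forall>m. sgn (x m - xe) \<in> sphere 0 1" using x(4) by (simp add: norm_sgn)
  then obtain u \<rho> where u: "u \<in> sphere 0 1" and \<rho>: "strict_mono \<rho>"
    and lim: "((\<lambda>m. sgn (x m - xe)) \<circ> \<rho>) \<longlonglongrightarrow> u"
    using compact_sphere[of "0::real^'n" 1] unfolding compact_def by meson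
  define z where "z = x \<circ> \<rho>"
  define y where "y m = xe + \<theta> (\<rho> m) *\<^sub>R (z m - xe)" for m
  have bound: "norm (z m - xe) \<le> R / Suc m" for m
  proof -
    have "norm (z m - xe) \<le> R / Suc (\<rho> m)"
      using x(1)[of "\<rho> m"] by (simp add: z_def dist_norm norm_minus_commute)
    also have "\<dots> \<le> R / Suc m"
      using R seq_suble[OF \<rho>, of m] by (intro divide_left_mono) auto
    finally show ?thesis .
  qed
  have Rlim: "(\<lambda>m. R / Suc m) \<longlonglongrightarrow> 0"
    using LIMSEQ_Suc[OF lim_const_over_n[of R]] by simp
  have "(\<lambda>m. z m - xe) \<longlonglongrightarrow> 0"
    by (rule Lim_null_comparison[OF _ Rlim]) (use bound in auto)
  then have z: "z \<longlonglongrightarrow> xe" by (simp add: LIM_zero_iff)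
  have "norm (y m - xe) \<le> R / Suc m" for m
  proof -
    have "norm (y m - xe) \<le> 1 * norm (z m - xe)"
      using \<theta>(1,2)[of "\<rho> m"] unfolding y_def add_diff_cancel_left' norm_scaleR
      by (intro mult_right_mono) auto
    with bound[of m] show ?thesis by simp
  qed
  then have "(\<lambda>m. y m - xe) \<longlonglongrightarrow> 0"
    by (intro Lim_null_comparison[OF _ Rlim]) auto
  then have y: "y \<longlonglongrightarrow> xe" by (simp add: LIM_zero_iff)
  have z_ne: "z m \<noteq> xe" for m using x(4) by (simp add: z_def)
  then have y_ne: "y m \<noteq> xe" for m using \<theta>(1)[of "\<rho> m"] by (simp add: y_def)
  have sgn_z: "(\<lambda>m. sgn (z m - xe)) \<longlonglongrightarrow> u" using lim by (simp add: z_def o_def)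
  \<comment> \<open>The intermediate point lies on the same ray as the zero, so both sequences share
    the limit direction \<open>u\<close>.\<close>
  have sgn_eq: "sgn (y m - xe) = sgn (z m - xe)" for m
    using \<theta>(1)[of "\<rho> m"] by (simp add: y_def sgn_scaleR)
  have "grad (C k) xe \<bullet> u = 0" if "k \<in> K" for k
    using directional_limit[OF has_derivative_grad[OF C[OF that]] z z_ne sgn_z] x(3)[OF that]
    by (simp add: z_def LIMSEQ_const_iff)
  moreover have "(hess F xe *v u) \<bullet> u = 0"
  proof -
    have "(\<lambda>m. (grad F (y m) - grad F xe) /\<^sub>R norm (y m - xe)) \<longlonglongrightarrow> hess F xe *v u"
      by (rule directional_limit[OF has_derivative_grad_hess[OF F(2)] y y_ne])
        (use sgn_z in \<open>simp add: sgn_eq\<close>)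
    then have "(\<lambda>m. ((grad F (y m) - grad F xe) /\<^sub>R norm (y m - xe)) \<bullet> sgn (z m - xe))
        \<longlonglongrightarrow> (hess F xe *v u) \<bullet> u"
      by (rule tendsto_inner[OF _ sgn_z])
    moreover have "grad F (y m) \<bullet> (z m - xe) = 0" for m
      using \<theta>(3)[of "\<rho> m"] by (simp add: y_def z_def)
    ultimately show ?thesis by (simp add: F(3) sgn_div_norm LIMSEQ_const_iff)
  qed
  ultimately show False using def[of u] u by (metis dist_0_norm mem_sphere norm_zero zero_neq_one)
qed

section \<open>Lipschitz fields and conserved quantities\<close>

text \<open>The gradient is continuous, hence bounded on the compact set, and convexity allows the
  mean value inequality.\<close>

lemma Cinf_lipschitz:
  fixes f :: "real^'n \<Rightarrow> real"
  assumes "open \<Omega>" "Cinf \<Omega> f" "compact S" "convex S" "S \<subseteq> \<Omega>"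
  shows "\<exists>L. L-lipschitz_on S f"
proof -
  have "continuous_on S (grad f)"
  proof (rule continuous_at_imp_continuous_on, rule ballI)
    fix x assume "x \<in> S"
    then show "isCont (grad f) x"
      using has_derivative_grad_hess[of f x] CinfD1[OF assms(2,1)] assms(5)
      by (meson has_derivative_continuous subsetD)
  qed
  then have "bounded (grad f ` S)"
    using assms(3) by (intro compact_imp_bounded compact_continuous_image)
  then obtain B where B: "\<And>x. x \<in> S \<Longrightarrow> norm (grad f x) \<le> B"
    unfolding bounded_iff by blast
  have "norm (f x - f y) \<le> B * norm (x - y)" if "x \<in> S" "y \<in> S" for x y
  proof (rule differentiable_bound[OF assms(4)])
    show "(f has_derivative (\<lambda>h. grad f x \<bullet> h)) (at x within S)" if "x \<in> S" for x
      using CinfD0[OF assms(2,1)] assms(5) that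
      by (blast intro: has_derivative_at_withinI has_derivative_grad)
    show "onorm (\<lambda>h. grad f x \<bullet> h) \<le> B" if "x \<in> S" for x
    proof (rule onorm_le)
      fix h
      have "norm (grad f x \<bullet> h) \<le> norm (grad f x) * norm h"
        by (simp add: Cauchy_Schwarz_ineq2)
      also have "\<dots> \<le> B * norm h" using B[OF that] by (intro mult_right_mono) auto
      finally show "norm (grad f x \<bullet> h) \<le> B * norm h" .
    qed
  qed (use that in auto)
  \<comment> \<open>A Lipschitz constant must be nonnegative, which \<open>B\<close> need not be
    when \<open>S\<close> is empty.\<close>
  then have "norm (f x - f y) \<le> \<bar>B\<bar> * norm (x - y)" if "x \<in> S" "y \<in> S" for x y
    using that mult_right_mono[OF abs_ge_self[of B] norm_ge_zero[of "x - y"]] by fastforce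
  then have "\<bar>B\<bar>-lipschitz_on S f"
    by (intro lipschitz_onI) (auto simp: dist_norm)
  then show ?thesis ..
qed

lemma lipschitz_mult:
  fixes f g :: "'a::metric_space \<Rightarrow> real"
  assumes "compact S" "\<exists>L. L-lipschitz_on S f" "\<exists>L. L-lipschitz_on S g"
  shows "\<exists>L. L-lipschitz_on S (\<lambda>x. f x * g x)"
proof -
  obtain L M where L: "L-lipschitz_on S f" and M: "M-lipschitz_on S g" using assms(2,3) by blast
  have "bounded (f ` S)" "bounded (g ` S)"
    using assms(1) L M lipschitz_on_continuous_on compact_continuous_image compact_imp_bounded
    by blast+
  then obtain P Q where P: "\<And>x. x \<in> S \<Longrightarrow> \<bar>f x\<bar> \<le> P" and Q: "\<And>x. x \<in> S \<Longrightarrow> \<bar>g x\<bar> \<le> Q"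
    by (auto simp: bounded_iff)
  have nn: "0 \<le> L" "0 \<le> M" using L M lipschitz_on_nonneg by blast+
  have "(\<bar>P\<bar> * M + \<bar>Q\<bar> * L)-lipschitz_on S (\<lambda>x. f x * g x)"
  proof (rule lipschitz_onI)
    fix x y assume xy: "x \<in> S" "y \<in> S"
    have "\<bar>f x * g x - f y * g y\<bar> = \<bar>f x * (g x - g y) + g y * (f x - f y)\<bar>"
      by (simp add: algebra_simps)
    also have "\<dots> \<le> \<bar>f x\<bar> * \<bar>g x - g y\<bar> + \<bar>g y\<bar> * \<bar>f x - f y\<bar>"
      using abs_triangle_ineq by (metis abs_mult)
    also have "\<dots> \<le> \<bar>P\<bar> * (M * dist x y) + \<bar>Q\<bar> * (L * dist x y)"
      using P[OF xy(1)] Q[OF xy(2)] lipschitz_onD[OF L xy] lipschitz_onD[OF M xy] nn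
      by (intro add_mono mult_mono) (auto simp: dist_real_def)
    finally show "dist (f x * g x) (f y * g y) \<le> (\<bar>P\<bar> * M + \<bar>Q\<bar> * L) * dist x y"
      by (simp add: dist_real_def algebra_simps)
  qed (use nn in auto)
  then show ?thesis ..
qed

lemma lipschitz_sum:
  fixes f :: "'i \<Rightarrow> 'a::metric_space \<Rightarrow> 'b::real_normed_vector"
  assumes "finite I" "\<And>i. i \<in> I \<Longrightarrow> \<exists>L. L-lipschitz_on S (f i)"
  shows "\<exists>L. L-lipschitz_on S (\<lambda>x. \<Sum>i\<in>I. f i x)"
  using assms
proof (induction I rule: finite_induct)
  case empty
  then show ?case using lipschitz_on_constant[of S "0::'b"] by auto
next
  case (insert i I)
  then obtain L M where "L-lipschitz_on S (f i)" "M-lipschitz_on S (\<lambda>x. \<Sum>i\<in>I. f i x)"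
    by (metis insertCI)
  from lipschitz_on_add[OF this] insert show ?case by auto
qed

lemma lipschitz_prod:
  fixes f :: "'i \<Rightarrow> 'a::metric_space \<Rightarrow> real"
  assumes "finite I" "compact S" "\<And>i. i \<in> I \<Longrightarrow> \<exists>L. L-lipschitz_on S (f i)"
  shows "\<exists>L. L-lipschitz_on S (\<lambda>x. \<Prod>i\<in>I. f i x)"
  using assms(1,3)
proof (induction I rule: finite_induct)
  case empty
  then show ?case using lipschitz_on_constant[of S "1::real"] by auto
next
  case (insert i I)
  then show ?case using lipschitz_mult[OF assms(2), of "f i" "\<lambda>x. \<Prod>i\<in>I. f i x"] by auto
qed

lemma lipschitz_vec:
  fixes f :: "'a::metric_space \<Rightarrow> real^'n"
  assumes "\<And>i. \<exists>L. L-lipschitz_on S (\<lambda>x. f x $ i)"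
  shows "\<exists>L. L-lipschitz_on S f"
proof -
  obtain L where L: "\<And>i. (L i)-lipschitz_on S (\<lambda>x. f x $ i)" using assms by metis
  have "(\<Sum>i\<in>UNIV. L i)-lipschitz_on S f"
  proof (rule lipschitz_onI)
    fix x y assume xy: "x \<in> S" "y \<in> S"
    have "dist (f x) (f y) \<le> (\<Sum>i\<in>UNIV. \<bar>(f x - f y) $ i\<bar>)"
      unfolding dist_norm by (rule norm_le_l1_cart)
    also have "\<dots> \<le> (\<Sum>i\<in>UNIV. L i * dist x y)"
      using lipschitz_onD[OF L xy] by (intro sum_mono) (simp add: dist_real_def)
    finally show "dist (f x) (f y) \<le> (\<Sum>i\<in>UNIV. L i) * dist x y"
      by (simp add: sum_distrib_right)
  qed (use L lipschitz_on_nonneg in \<open>auto intro!: sum_nonneg\<close>)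
  then show ?thesis ..
qed

section \<open>Global solutions of bounded Lipschitz equations\<close>

lemma integral_has_vector_derivative_atLeast:
  fixes h :: "real \<Rightarrow> 'a::banach"
  assumes "continuous_on UNIV h" "0 \<le> t"
  shows "((\<lambda>t. integral {0..t} h) has_vector_derivative h t) (at t within {0..})"
proof -
  have "continuous_on {0..t + 1} h" using assms(1) continuous_on_subset by blast
  then have "((\<lambda>t. integral {0..t} h) has_vector_derivative h t) (at t within {0..t + 1})"
    by (rule integral_has_vector_derivative) (use assms in auto)
  moreover have "at t within {0..t + 1} = at t within {0..}"
    by (rule at_within_nhd[of _ "{..<t + 1}"]) auto
  ultimately show ?thesis by simp
qed

text \<open>Picard iteration contracts in the norm weighted by \<open>exp (- M * t)\<close>, which gives the
  solution on the whole half line at once.\<close>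
lemma lipschitz_bounded_global_solution:
  fixes Y :: "'a::banach \<Rightarrow> 'a"
  assumes lip: "L-lipschitz_on UNIV Y" and bdd: "\<And>x. norm (Y x) \<le> K"
  shows "\<exists>\<phi>. \<phi> 0 = x0 \<and> (\<forall>t\<ge>0. (\<phi> has_vector_derivative Y (\<phi> t)) (at t within {0..}))"
proof -
  \<comment> \<open>The contraction factor will be \<open>(L + 1) / M\<close>, that is 1/2;
    \<open>L + 1\<close> instead of \<open>L\<close> keeps \<open>M\<close> positive.\<close>
  define M where "M = 2 * (L + 1)"
  have "L \<ge> 0" using lip by (rule lipschitz_on_nonneg)
  then have M: "M > 0" by (simp add: M_def)
  have M2: "L + 1 = M / 2" by (simp add: M_def)
  have K: "K \<ge> 0" using bdd[of 0] norm_ge_zero order_trans by blast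
  \<comment> \<open>The unknown \<open>\<psi>\<close> is the solution divided by
    \<open>exp (M * t)\<close>. This makes it a bounded function, and the sup metric on
    \<open>\<psi>\<close> is the weighted metric on solutions.\<close>
  define h where "h \<psi> s = Y (exp (M * s) *\<^sub>R apply_bcontfun \<psi> s)" for \<psi> :: "real \<Rightarrow>\<^sub>C 'a" and s
  have h_cont: "continuous_on S (h \<psi>)" for S \<psi>
  proof -
    have "continuous_on UNIV Y" using lip by (rule lipschitz_on_continuous_on)
    then show ?thesis unfolding h_def
      by (rule continuous_on_compose2) (auto intro!: continuous_intros)
  qed
  define I where "I \<psi> t = integral {0..t} (h \<psi>)" for \<psi> t
  have I_deriv: "(I \<psi> has_vector_derivative h \<psi> t) (at t within {0..})" if "0 \<le> t" for \<psi> t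
    unfolding I_def by (rule integral_has_vector_derivative_atLeast[OF h_cont that])
  have I_bound: "norm (I \<psi> t) \<le> K * t" if "0 \<le> t" for \<psi> t
    using integral_bound[OF that h_cont, of \<psi> K] bdd by (simp add: I_def h_def)
  \<comment> \<open>\<open>max 0 t\<close> extends the iteration by a constant to negative times, as
    bounded continuous functions live on the whole line.\<close>
  define \<Phi> where "\<Phi> \<psi> t = exp (- M * max 0 t) *\<^sub>R (x0 + I \<psi> (max 0 t))" for \<psi> t
  have \<Phi>_bcont: "\<Phi> \<psi> \<in> bcontfun" for \<psi>
  proof (rule bcontfun_normI)
    have "continuous_on {0..} (I \<psi>)"
      unfolding continuous_on_eq_continuous_within
      using I_deriv has_vector_derivative_continuous by fastforce
    then have "continuous_on UNIV (\<lambda>t. I \<psi> (max 0 t))"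
      by (rule continuous_on_compose2) (auto intro!: continuous_intros)
    then show "continuous_on UNIV (\<Phi> \<psi>)"
      unfolding \<Phi>_def by (intro continuous_intros)
    fix t :: real
    let ?t = "max 0 t"
    have t: "?t \<ge> 0" by simp
    have "norm (\<Phi> \<psi> t) \<le> exp (- M * ?t) * (norm x0 + K * ?t)"
      unfolding \<Phi>_def norm_scaleR using I_bound[OF t, of \<psi>] norm_triangle_ineq[of x0 "I \<psi> ?t"]
      by (intro mult_mono) auto
    also have "\<dots> \<le> norm x0 + K / M"
    proof -
      \<comment> \<open>The exponential weight absorbs the linear growth \<open>K * t\<close> of the
        integral.\<close>
      have "M * ?t \<le> exp (M * ?t)"
        using exp_ge_add_one_self[of "M * ?t"] by linarith
      then have "exp (- (M * ?t)) * (M * ?t) \<le> exp (- (M * ?t)) * exp (M * ?t)"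
        by (rule mult_left_mono) simp
      then have "exp (- M * ?t) * (M * ?t) \<le> 1" by (simp add: exp_minus)
      then have "K / M * (exp (- M * ?t) * (M * ?t)) \<le> K / M * 1"
        using K M by (intro mult_left_mono) auto
      moreover have "K / M * (exp (- M * ?t) * (M * ?t)) = exp (- M * ?t) * (K * ?t)"
        using M by simp
      moreover have "exp (- M * ?t) * norm x0 \<le> 1 * norm x0"
        using M by (intro mult_right_mono) auto
      ultimately show ?thesis by (simp add: distrib_left)
    qed
    finally show "norm (\<Phi> \<psi> t) \<le> norm x0 + K / M" .
  qed
  define F where "F \<psi> = Bcontfun (\<Phi> \<psi>)" for \<psi>
  have F: "apply_bcontfun (F \<psi>) = \<Phi> \<psi>" for \<psi>
    unfolding F_def by (rule Bcontfun_inverse[OF \<Phi>_bcont])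
  have "\<exists>!\<psi>. F \<psi> = \<psi>"
  proof (rule banach_fix_type[of "1/2"]; (intro allI dist_bound)?)
    fix \<psi> \<eta> :: "real \<Rightarrow>\<^sub>C 'a" and t :: real
    let ?t = "max 0 t" and ?d = "dist \<psi> \<eta>"
    have t: "?t \<ge> 0" by simp
    have e: "((\<lambda>s. exp (M * s)) has_integral (exp (M * ?t) / M - exp (M * 0) / M)) {0..?t}"
      using M by (intro fundamental_theorem_of_calculus)
        (auto simp: has_real_derivative_iff_has_vector_derivative[symmetric]
          intro!: derivative_eq_intros)
    have "norm (I \<psi> ?t - I \<eta> ?t) = norm (integral {0..?t} (\<lambda>s. h \<psi> s - h \<eta> s))"
      unfolding I_def by (subst integral_diff) (auto intro!: integrable_continuous_interval h_cont)
    also have "\<dots> \<le> integral {0..?t} (\<lambda>s. (M / 2 * ?d) * exp (M * s))"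
    proof (rule integral_norm_bound_integral)
      show "(\<lambda>s. h \<psi> s - h \<eta> s) integrable_on {0..?t}"
        by (intro integrable_continuous_interval continuous_intros h_cont)
      show "(\<lambda>s. (M / 2 * ?d) * exp (M * s)) integrable_on {0..?t}"
        by (intro integrable_continuous_interval continuous_intros)
      fix s assume "s \<in> {0..?t}"
      have "norm (h \<psi> s - h \<eta> s) \<le> L * norm (exp (M * s) *\<^sub>R \<psi> s - exp (M * s) *\<^sub>R \<eta> s)"
        unfolding h_def using lipschitz_on_normD[OF lip] by blast
      also have "\<dots> = L * (exp (M * s) * dist (\<psi> s) (\<eta> s))"
        by (simp add: dist_norm flip: scaleR_diff_right)
      also have "\<dots> \<le> (L + 1) * (exp (M * s) * ?d)"
        using \<open>L \<ge> 0\<close> by (intro mult_mono dist_bounded) auto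
      finally show "norm (h \<psi> s - h \<eta> s) \<le> (M / 2 * ?d) * exp (M * s)"
        unfolding M2 by (simp add: mult_ac)
    qed
    also have "\<dots> = (M / 2 * ?d) * (exp (M * ?t) / M - exp (M * 0) / M)"
      using has_integral_mult_right[OF e] by (rule integral_unique)
    also have "\<dots> \<le> 1 / 2 * ?d * exp (M * ?t)"
      using M by (simp add: field_simps)
    finally have "norm (I \<psi> ?t - I \<eta> ?t) \<le> 1 / 2 * ?d * exp (M * ?t)" .
    then have "exp (- (M * ?t)) * norm (I \<psi> ?t - I \<eta> ?t)
        \<le> exp (- (M * ?t)) * (1 / 2 * ?d * exp (M * ?t))"
      by (rule mult_left_mono) simp
    also have "\<dots> = 1 / 2 * ?d" by (simp add: exp_minus)
    finally show "dist (apply_bcontfun (F \<psi>) t) (apply_bcontfun (F \<eta>) t) \<le> 1 / 2 * dist \<psi> \<eta>"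
      by (simp add: F \<Phi>_def dist_norm flip: scaleR_diff_right)
  qed auto
  then obtain \<psi> where "F \<psi> = \<psi>" by blast
  define \<phi> where "\<phi> t = exp (M * t) *\<^sub>R apply_bcontfun \<psi> t" for t
  have \<phi>: "\<phi> t = x0 + I \<psi> t" if "t \<ge> 0" for t
  proof -
    have "apply_bcontfun \<psi> t = \<Phi> \<psi> t" using F[of \<psi>] \<open>F \<psi> = \<psi>\<close> by simp
    then show ?thesis using that by (simp add: \<phi>_def \<Phi>_def exp_minus)
  qed
  show ?thesis
  proof (intro exI[of _ \<phi>] conjI allI impI)
    show "\<phi> 0 = x0" using \<phi>[of 0] by (simp add: I_def)
    fix t :: real assume t: "t \<ge> 0"
    have "((\<lambda>t. x0 + I \<psi> t) has_vector_derivative (0 + h \<psi> t)) (at t within {0..})"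
      by (intro has_vector_derivative_add has_vector_derivative_const I_deriv t)
    then have "(\<phi> has_vector_derivative (0 + h \<psi> t)) (at t within {0..})"
      by (rule has_vector_derivative_transform[rotated 2]) (use \<phi> t in auto)
    then show "(\<phi> has_vector_derivative Y (\<phi> t)) (at t within {0..})"
      by (simp add: h_def \<phi>_def)
  qed
qed

section \<open>Confinement and stability by a conserved quantity\<close>

text \<open>Up to the first time on the sphere the curve stays in the closed ball, where
  \<open>Y\<close> and \<open>X\<close> agree. So \<open>V\<close> is conserved until then, but it
  starts below \<open>m\<close> and is at least \<open>m\<close> on the sphere.\<close>

lemma solution_confined:
  fixes X Y :: "'a::real_normed_vector \<Rightarrow> 'a" and V :: "'a \<Rightarrow> real"
  assumes sol: "\<And>t. t \<in> {0..T} \<Longrightarrow> (\<phi> has_vector_derivative Y (\<phi> t)) (at t within {0..T})"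
    and YX: "\<And>x. x \<in> cball xe r \<Longrightarrow> Y x = X x"
    and conserved: "\<And>T. 0 \<le> T \<Longrightarrow>
      (\<And>t. t \<in> {0..T} \<Longrightarrow> \<phi> t \<in> cball xe r \<and> (\<phi> has_vector_derivative X (\<phi> t)) (at t within {0..T}))
      \<Longrightarrow> V (\<phi> T) = V (\<phi> 0)"
    and start: "dist (\<phi> 0) xe < r" "V (\<phi> 0) < m"
    and sphere: "\<And>x. dist x xe = r \<Longrightarrow> m \<le> V x"
    and t: "t \<in> {0..T}"
  shows "dist (\<phi> t) xe < r"
proof (rule ccontr)
  assume "\<not> dist (\<phi> t) xe < r"
  have "continuous_on {0..T} \<phi>"
    unfolding continuous_on_eq_continuous_within
    using sol has_vector_derivative_continuous by blast
  then have cont: "continuous_on {0..T} (\<lambda>t. dist (\<phi> t) xe)" by (intro continuous_intros)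
  have hit: "\<exists>s\<in>{0..t}. dist (\<phi> s) xe = r" if "t \<in> {0..T}" "r \<le> dist (\<phi> t) xe" for t
    using IVT'[of "\<lambda>t. dist (\<phi> t) xe" 0 r t] that start(1) continuous_on_subset[OF cont, of "{0..t}"]
    by force
  let ?S = "{0..T} \<inter> (\<lambda>t. dist (\<phi> t) xe) -` {r}"
  have "compact ?S"
    using continuous_closed_preimage[OF cont, of "{r}"] bounded_subset[OF bounded_closed_interval]
    by (auto simp: compact_eq_bounded_closed)
  moreover have "?S \<noteq> {}" using hit[OF t] \<open>\<not> dist (\<phi> t) xe < r\<close> t by force
  \<comment> \<open>This is the first hitting time. Leaving the closed ball earlier would force an
    earlier hit by the intermediate value theorem.\<close>
  ultimately obtain s where s: "s \<in> ?S" "\<And>s'. s' \<in> ?S \<Longrightarrow> s \<le> s'"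
    by (meson compact_attains_inf)
  have "V (\<phi> s) = V (\<phi> 0)"
  proof (rule conserved)
    show "0 \<le> s" using s by simp
    fix t assume t: "t \<in> {0..s}"
    have "dist (\<phi> t) xe \<le> r"
    proof (rule ccontr)
      assume "\<not> dist (\<phi> t) xe \<le> r"
      then obtain s' where "s' \<in> {0..t}" "dist (\<phi> s') xe = r" using hit[of t] t s by auto
      moreover from this have "s' = t" using s(2)[of s'] s(1) t by force
      ultimately show False using \<open>\<not> dist (\<phi> t) xe \<le> r\<close> by simp
    qed
    then have ball: "\<phi> t \<in> cball xe r" by (simp add: dist_commute)
    moreover have "(\<phi> has_vector_derivative Y (\<phi> t)) (at t within {0..s})"
      by (rule has_vector_derivative_within_subset[OF sol]) (use s t in auto)
    ultimately show "\<phi> t \<in> cball xe r \<and> (\<phi> has_vector_derivative X (\<phi> t)) (at t within {0..s})"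
      using YX by simp
  qed
  with sphere[of "\<phi> s"] s start(2) show False by auto
qed

text \<open>The minimum of \<open>V\<close> on a small sphere is a positive barrier, and by
  continuity solutions starting close enough to \<open>xe\<close> start below it. Conservation of
  \<open>V\<close> prevents them from crossing.\<close>

lemma lyapunov_stable_conserved:
  fixes X :: "real^'n \<Rightarrow> real^'n" and V :: "real^'n \<Rightarrow> real"
  assumes r0: "r0 > 0" "cball xe r0 \<subseteq> \<Omega>"
    and lip: "L-lipschitz_on (cball xe r0) X"
    and V: "continuous_on (cball xe r0) V" "V xe = 0"
      "\<And>x. x \<in> cball xe r0 \<Longrightarrow> x \<noteq> xe \<Longrightarrow> V x > 0"
    and conserved: "\<And>\<phi> T. 0 \<le> T \<Longrightarrow>
      (\<And>t. t \<in> {0..T} \<Longrightarrow> \<phi> t \<in> \<Omega> \<and> (\<phi> has_vector_derivative X (\<phi> t)) (at t within {0..T}))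
      \<Longrightarrow> V (\<phi> T) = V (\<phi> 0)"
  shows "lyapunov_stable \<Omega> X xe"
  unfolding lyapunov_stable_def
proof (intro allI impI)
  fix \<epsilon> :: real assume "\<epsilon> > 0"
  define r where "r = min r0 \<epsilon>"
  have r: "r > 0" "r \<le> r0" "r \<le> \<epsilon>" using r0 \<open>\<epsilon> > 0\<close> by (auto simp: r_def)
  have sub: "cball xe r \<subseteq> cball xe r0" "sphere xe r \<subseteq> cball xe r0" using r by auto
  have "sphere xe r \<noteq> {}" using r by simp
  with V(1) sub(2) obtain z where z: "z \<in> sphere xe r" "\<And>x. x \<in> sphere xe r \<Longrightarrow> V z \<le> V x"
    using continuous_attains_inf[of "sphere xe r" V] continuous_on_subset[of "cball xe r0" V]
    by (metis compact_sphere)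
  have "V z > 0" using z(1) sub(2) r by (intro V(3)) auto
  moreover have "xe \<in> cball xe r0" using r0 by simp
  ultimately obtain \<delta> where \<delta>: "\<delta> > 0"
    "\<And>x. x \<in> cball xe r0 \<Longrightarrow> dist x xe < \<delta> \<Longrightarrow> dist (V x) (V xe) < V z"
    using V(1) unfolding continuous_on_iff by metis
  have "bounded (X ` cball xe r0)"
    by (intro compact_imp_bounded compact_continuous_image lipschitz_on_continuous_on[OF lip]) simp
  then obtain K where K: "\<And>x. x \<in> cball xe r0 \<Longrightarrow> norm (X x) \<le> K"
    unfolding bounded_iff by blast
  define Y where "Y x = X (closest_point (cball xe r0) x)" for x
  have cp: "closest_point (cball xe r0) x \<in> cball xe r0" for x
    using r0 by (intro closest_point_in_set) auto
  have Y_lip: "L-lipschitz_on UNIV Y"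
  proof (rule lipschitz_onI)
    show "L \<ge> 0" using lip by (rule lipschitz_on_nonneg)
    fix x y
    have "dist (Y x) (Y y) \<le> L * dist (closest_point (cball xe r0) x) (closest_point (cball xe r0) y)"
      unfolding Y_def by (rule lipschitz_onD[OF lip cp cp])
    also have "\<dots> \<le> L * dist x y"
      using \<open>L \<ge> 0\<close> r0 by (intro mult_left_mono closest_point_lipschitz) auto
    finally show "dist (Y x) (Y y) \<le> L * dist x y" .
  qed
  have YX: "Y x = X x" if "x \<in> cball xe r" for x
    using that sub by (simp add: Y_def closest_point_self subset_eq)
  \<comment> \<open>The field \<open>Z\<close> is kept general: it will be the truncated field
    \<open>Y\<close> for the existence of solutions, and \<open>X\<close> itself for the bound on
    all solutions.\<close>
  have confined: "dist (\<phi> t) xe < r"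
    if "dist (\<phi> 0) xe < min \<delta> r" "t \<in> {0..T}" "\<And>x. x \<in> cball xe r \<Longrightarrow> Z x = X x"
      "\<And>t. t \<in> {0..T} \<Longrightarrow> (\<phi> has_vector_derivative Z (\<phi> t)) (at t within {0..T})" for \<phi> Z T t
  proof (rule solution_confined[where Y=Z and X=X and T=T and V=V and m="V z"])
    show "V (\<phi> 0) < V z" using that(1) r \<delta>(2)[of "\<phi> 0"] V(2) by (auto simp: dist_commute)
    show "V z \<le> V x" if "dist x xe = r" for x using z(2) that by (simp add: dist_commute)
    show "V (\<phi> T) = V (\<phi> 0)" if "0 \<le> T" "\<And>t. t \<in> {0..T} \<Longrightarrow> \<phi> t \<in> cball xe r \<and>
        (\<phi> has_vector_derivative X (\<phi> t)) (at t within {0..T})" for T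
      using that sub(1) r0(2) by (intro conserved) blast+
  qed (use that in auto)
  show "\<exists>\<delta>>0. \<forall>x0. dist x0 xe < \<delta> \<longrightarrow>
      (\<exists>\<phi>. \<phi> 0 = x0 \<and> (\<forall>t\<ge>0. \<phi> t \<in> \<Omega> \<and> (\<phi> has_vector_derivative X (\<phi> t)) (at t within {0..}))) \<and>
      (\<forall>\<phi> T. \<phi> 0 = x0 \<and> (\<forall>t\<in>{0..T}. \<phi> t \<in> \<Omega> \<and> (\<phi> has_vector_derivative X (\<phi> t)) (at t within {0..T}))
          \<longrightarrow> (\<forall>t\<in>{0..T}. dist (\<phi> t) xe < \<epsilon>))"
  proof (intro exI[of _ "min \<delta> r"] conjI allI impI)
    show "0 < min \<delta> r" using \<delta> r by simp
    fix x0 assume x0: "dist x0 xe < min \<delta> r"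
    obtain \<phi> where \<phi>: "\<phi> 0 = x0"
      "\<And>t. t \<ge> 0 \<Longrightarrow> (\<phi> has_vector_derivative Y (\<phi> t)) (at t within {0..})"
      using lipschitz_bounded_global_solution[OF Y_lip, of K x0] K cp by (auto simp: Y_def)
    have "\<phi> t \<in> cball xe r" if "t \<ge> 0" for t
    proof -
      have "(\<phi> has_vector_derivative Y (\<phi> s)) (at s within {0..t})" if "s \<in> {0..t}" for s
        by (rule has_vector_derivative_within_subset[OF \<phi>(2)]) (use that in auto)
      then have "dist (\<phi> t) xe < r"
        by (intro confined[where Z=Y and T=t]) (use \<phi>(1) x0 that YX in auto)
      then show ?thesis by (simp add: dist_commute)
    qed
    then show "\<exists>\<phi>. \<phi> 0 = x0 \<and> (\<forall>t\<ge>0. \<phi> t \<in> \<Omega> \<and> (\<phi> has_vector_derivative X (\<phi> t)) (at t within {0..}))"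
      using \<phi> YX sub(1) r0(2) by (metis subset_eq)
    fix \<phi> T
    assume *: "\<phi> 0 = x0 \<and> (\<forall>t\<in>{0..T}. \<phi> t \<in> \<Omega> \<and> (\<phi> has_vector_derivative X (\<phi> t)) (at t within {0..T}))"
    show "\<forall>t\<in>{0..T}. dist (\<phi> t) xe < \<epsilon>"
    proof
      fix t assume "t \<in> {0..T}"
      then have "dist (\<phi> t) xe < r"
        by (intro confined[where Z=X and T=T]) (use * x0 in auto)
      with r show "dist (\<phi> t) xe < \<epsilon>" by simp
    qed
  qed
qed

section \<open>The vector field\<close>

lemma grad_coordinate: "grad (\<lambda>y. y $ i) x = axis i 1"
  by (rule grad_eqI) (simp add: inner_axis' bounded_linear_imp_has_derivative bounded_linear_vec_nth)

text \<open>Each component is a polynomial in \<open>\<nu>\<close>, first derivatives of the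
  \<open>C k\<close> and constants, so closure of Lipschitz functions under sums and products on
  compact sets applies.\<close>

lemma lipschitz_vfX:
  fixes \<nu> :: "(real,'n::{finite,wellorder}) vec \<Rightarrow> real"
  assumes n: "CARD('n) \<ge> 2" and \<Omega>: "open \<Omega>" "compact S" "convex S" "S \<subseteq> \<Omega>"
    and \<nu>: "Cinf \<Omega> \<nu>" and C: "\<forall>k\<in>{1..CARD('n) - 1}. Cinf \<Omega> (C k)"
  shows "\<exists>L. L-lipschitz_on S (vfX \<nu> C)"
proof (rule lipschitz_vec)
  fix i :: 'n
  let ?fs = "\<lambda>k. if k \<le> CARD('n) - 2 then C k
      else if k = CARD('n) - 1 then (\<lambda>y. y $ i) else C (CARD('n) - 1)"
  note lip = Cinf_lipschitz[OF \<Omega>(1) _ \<Omega>(2-4)]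
  have entry: "\<exists>L. L-lipschitz_on S (\<lambda>x. grad (?fs (rank a + 1)) x $ b)" for a b :: 'n
  proof -
    have CC: "\<exists>L. L-lipschitz_on S (\<lambda>x. grad (C k) x $ b)" if "k \<in> {1..CARD('n) - 1}" for k
      using lip[OF Cinf_pd] C that by (simp add: grad_def)
    consider "rank a + 1 \<le> CARD('n) - 2" | "rank a + 1 = CARD('n) - 1" "\<not> rank a + 1 \<le> CARD('n) - 2"
      | "rank a + 1 \<noteq> CARD('n) - 1" "\<not> rank a + 1 \<le> CARD('n) - 2" by blast
    then show ?thesis
    proof cases
      case 1
      then show ?thesis using CC[of "rank a + 1"] by simp
    next
      case 2
      then show ?thesis
        using lipschitz_on_constant[of S "axis i 1 $ b :: real"] by (auto simp: grad_coordinate)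
    next
      case 3
      then show ?thesis using CC[of "CARD('n) - 1"] n by simp
    qed
  qed
  have "\<exists>L. L-lipschitz_on S (\<lambda>x. jacdet ?fs x)"
    unfolding jacdet_def det_def vec_lambda_beta
    by (intro lipschitz_sum lipschitz_mult lipschitz_prod \<Omega>(2) entry)
      (auto intro: lipschitz_on_constant)
  then show "\<exists>L. L-lipschitz_on S (\<lambda>x. vfX \<nu> C x $ i)"
    unfolding vfX_def vec_lambda_beta by (rule lipschitz_mult[OF \<Omega>(2) lip[OF \<nu>]])
qed

text \<open>By linearity in the coordinate row, the pairing is \<open>\<nu> x\<close> times the
  determinant with that row replaced by \<open>grad (C k) x\<close>, which already occurs as another
  row.\<close>

lemma grad_inner_vfX:
  fixes C :: "nat \<Rightarrow> (real,'n::{finite,wellorder}) vec \<Rightarrow> real"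
  assumes n: "CARD('n) \<ge> 2" and k: "k \<in> {1..CARD('n) - 1}"
  shows "grad (C k) x \<bullet> vfX \<nu> C x = 0"
proof -
  \<comment> \<open>Ranks start at 0, so the coordinate function, number \<open>CARD('n) - 1\<close>
    in the list, sits in the row of rank \<open>CARD('n) - 2\<close>.\<close>
  obtain p :: 'n where p: "rank p = CARD('n) - 2" using rank_surj[of "CARD('n) - 2", where 'n='n] n by auto
  \<comment> \<open>This is the rank of the row holding \<open>grad (C k) x\<close>: shifted down by
    one for the first functions, the last row for the Hamiltonian
    \<open>C (CARD('n) - 1)\<close>.\<close>
  define e where "e = (if k \<le> CARD('n) - 2 then k - 1 else CARD('n) - 1)"
  have e: "e < CARD('n)" "e \<noteq> CARD('n) - 2"
    "(if e + 1 \<le> CARD('n) - 2 then e + 1 else CARD('n) - 1) = k"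
    using n k by (auto simp: e_def)
  obtain q :: 'n where q: "rank q = e" using rank_surj[OF e(1)] by blast
  have "rank q \<noteq> rank p" using p q e by simp
  then have "q \<noteq> p" by auto
  define g where "g a = grad (C (if rank a + 1 \<le> CARD('n) - 2 then rank a + 1 else CARD('n) - 1)) x"
    for a :: 'n
  have gq: "g q = grad (C k) x" unfolding g_def q e(3) ..
  have comp: "vfX \<nu> C x $ i = \<nu> x * det (\<chi> a. if a = p then axis i 1 else g a)" for i
  proof -
    have "grad (if rank a + 1 \<le> CARD('n) - 2 then C (rank a + 1)
        else if rank a + 1 = CARD('n) - 1 then (\<lambda>y. y $ i) else C (CARD('n) - 1)) x
      = (if a = p then axis i 1 else g a)" for a
    proof (cases "a = p")
      case True
      then have "rank a + 1 = CARD('n) - 1" "\<not> rank a + 1 \<le> CARD('n) - 2" using p n by auto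
      then show ?thesis using True by (simp add: grad_coordinate)
    next
      case False
      then have "rank a \<noteq> rank p" by simp
      then have "rank a + 1 \<noteq> CARD('n) - 1" using p n by linarith
      then show ?thesis using False by (simp add: g_def)
    qed
    then show ?thesis unfolding vfX_def jacdet_def by (simp add: vec_lambda_eta)
  qed
  let ?v = "grad (C k) x"
  have "det (\<chi> a. if a = p then ?v else g a)
      = det (\<chi> a. if a = p then (\<Sum>i\<in>UNIV. ?v $ i *s axis i 1) else g a)"
    unfolding basis_expansion ..
  also have "\<dots> = (\<Sum>i\<in>UNIV. ?v $ i * det (\<chi> a. if a = p then axis i 1 else g a))"
    unfolding det_linear_row_sum[of UNIV p "\<lambda>_ i. ?v $ i *s axis i 1" g, OF finite]
    by (intro sum.cong refl det_row_mul)
  finally have D: "det (\<chi> a. if a = p then ?v else g a)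
      = (\<Sum>i\<in>UNIV. ?v $ i * det (\<chi> a. if a = p then axis i 1 else g a))" .
  have "?v \<bullet> vfX \<nu> C x
      = (\<Sum>i\<in>UNIV. ?v $ i * (\<nu> x * det (\<chi> a. if a = p then axis i 1 else g a)))"
    unfolding inner_vec_def comp by simp
  also have "\<dots> = \<nu> x * det (\<chi> a. if a = p then ?v else g a)"
    unfolding D sum_distrib_left by (intro sum.cong refl mult.left_commute)
  also have "det (\<chi> a. if a = p then ?v else g a) = 0"
    by (rule det_identical_rows[OF \<open>q \<noteq> p\<close>]) (simp add: row_def gq \<open>q \<noteq> p\<close>)
  finally show ?thesis by simp
qed

lemma conserved_along_solution:
  fixes f :: "real^'n \<Rightarrow> real"
  assumes "0 \<le> T" and f: "\<And>x. x \<in> \<Omega> \<Longrightarrow> f differentiable (at x)" "\<And>x. grad f x \<bullet> X x = 0"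
    and sol: "\<And>t. t \<in> {0..T} \<Longrightarrow> \<phi> t \<in> \<Omega> \<and> (\<phi> has_vector_derivative X (\<phi> t)) (at t within {0..T})"
  shows "f (\<phi> T) = f (\<phi> 0)"
proof -
  have "((f \<circ> \<phi>) has_vector_derivative 0) (at t within {0..T})" if "t \<in> {0..T}" for t
    using vector_derivative_diff_chain_within[of \<phi> "X (\<phi> t)" t "{0..T}" f "\<lambda>h. grad f (\<phi> t) \<bullet> h"]
      sol[OF that] has_derivative_at_withinI[OF has_derivative_grad[OF f(1)]] f(2) by simp
  then obtain c where "\<And>t. t \<in> {0..T} \<Longrightarrow> (f \<circ> \<phi>) t = c"
    using has_vector_derivative_zero_constant[of "{0..T}" "f \<circ> \<phi>"] by auto
  from this[of 0] this[of T] assms(1) show ?thesis by simp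
qed

section \<open>Multipliers and stability of the equilibrium\<close>

text \<open>\<open>lam\<close> is a definite description, so its equation requires existence and
  uniqueness. The vanishing Gram determinant of all gradients gives existence, the nonzero one of
  the first \<open>CARD('n) - 2\<close> gives uniqueness.\<close>

lemma lam_multiplier:
  fixes C :: "nat \<Rightarrow> (real,'n::{finite,wellorder}) vec \<Rightarrow> real"
  assumes n: "CARD('n) \<ge> 2" and xe: "xe \<in> Eset \<Omega> \<nu> C"
  shows "grad (C (CARD('n) - 1)) xe + (\<Sum>k=1..CARD('n) - 2. lam C xe k *\<^sub>R grad (C k) xe) = 0"
proof -
  define m where "m = CARD('n) - 2"
  define c where "c a = grad (C (a + 1)) xe" for a
  have m: "CARD('n) - 1 = Suc m" "CARD('n) - 2 = m" "Suc m \<le> CARD('n)" "m \<le> CARD('n)"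
    using n by (auto simp: m_def)
  have nz: "det_nat m (\<lambda>a b. c a \<bullet> c b) \<noteq> 0" and z: "det_nat (Suc m) (\<lambda>a b. c a \<bullet> c b) = 0"
    using xe unfolding Eset_def wedge_inner_def m c_def by auto
  have shift: "(\<Sum>k=1..m. l k *\<^sub>R grad (C k) xe) = (\<Sum>a<m. l (Suc a) *\<^sub>R c a)" for l
    by (simp add: sum.atLeast1_atMost_eq c_def)
  let ?P = "\<lambda>l. (\<forall>k. k \<notin> {1..m} \<longrightarrow> l k = 0) \<and>
      grad (C (Suc m)) xe + (\<Sum>k=1..m. l k *\<^sub>R grad (C k) xe) = 0"
  obtain l where "c m + (\<Sum>a<m. l a *\<^sub>R c a) = 0" using gram_dependent[OF m(3) nz z] by blast
  \<comment> \<open>The Gram lemmas count from 0 and the multipliers from 1; zeros outside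
    \<open>{1..m}\<close> make the coefficient function unique as a total function.\<close>
  then have ex: "?P (\<lambda>k. if k \<in> {1..m} then l (k - 1) else 0)"
    unfolding shift by (simp add: c_def)
  have uniq: "l1 = l2" if "?P l1" "?P l2" for l1 l2
  proof
    fix k
    have "(\<Sum>a<m. (l1 (Suc a) - l2 (Suc a)) *\<^sub>R c a)
        = (\<Sum>a<m. l1 (Suc a) *\<^sub>R c a) - (\<Sum>a<m. l2 (Suc a) *\<^sub>R c a)"
      by (simp add: scaleR_diff_left sum_subtractf)
    also have "\<dots> = 0" using that unfolding shift by (metis add_left_cancel right_minus_eq)
    finally have "l1 (Suc a) - l2 (Suc a) = 0" if "a < m" for a
      using gram_independent[OF m(4) nz, of "\<lambda>a. l1 (Suc a) - l2 (Suc a)"] that by blast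
    from this[of "k - 1"] show "l1 k = l2 k" using that by (cases "k \<in> {1..m}") auto
  qed
  have "\<exists>!l. ?P l" by (rule ex1I[of ?P, OF ex]) (rule uniq[OF _ ex])
  from theI'[of ?P, OF this] have "?P (lam C xe)" unfolding lam_def m .
  then show ?thesis unfolding m by blast
qed

theorem theorem5p6:
  fixes \<Omega> :: "(real,'n::{finite,wellorder}) vec set"
    and \<nu> :: "(real,'n) vec \<Rightarrow> real"
    and C :: "nat \<Rightarrow> (real,'n) vec \<Rightarrow> real"
    and xe :: "(real,'n) vec"
  assumes "CARD('n) \<ge> 2"
    and "open \<Omega>"
    and "Cinf \<Omega> \<nu>"
    and "\<forall>k\<in>{1..CARD('n) - 1}. Cinf \<Omega> (C k)"
    and "xe \<in> Eset \<Omega> \<nu> C"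
    and "vfX \<nu> C xe = 0"
    and "non_degenerate C xe"
    and "IX \<nu> C xe > 0"
  shows "lyapunov_stable \<Omega> (vfX \<nu> C) xe"
proof -
  let ?n = "CARD('n)"
  define F where "F = Flam C xe"
  define V where "V x = (\<Sum>k=1..?n - 1. (C k x - C k xe)\<^sup>2)" for x
  have xe: "xe \<in> \<Omega>" "\<nu> xe \<noteq> 0" using assms(5) by (auto simp: Eset_def)
  have CC: "Cinf \<Omega> (C k)" if "k \<in> {1..?n - 1}" for k using assms(4) that by blast
  have Cdiff: "C k differentiable (at x)" if "k \<in> {1..?n - 1}" "x \<in> \<Omega>" for k x
    using CinfD0[OF CC assms(2)] that by blast
  have F: "Cinf \<Omega> F"
    unfolding F_def Flam_def using assms(1)
    by (intro Cinf_linear_combination assms(2) CC) auto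
  have "(F has_derivative (\<lambda>h. (grad (C (?n - 1)) xe
      + (\<Sum>k=1..?n - 2. lam C xe k *\<^sub>R grad (C k) xe)) \<bullet> h)) (at xe)"
    unfolding F_def Flam_def inner_add_left inner_sum_left inner_scaleR_left using assms(1) xe(1)
    by (intro has_derivative_add has_derivative_sum has_derivative_mult_right
        has_derivative_grad Cdiff) auto
  then have grad_F: "grad F xe = 0"
    using lam_multiplier[OF assms(1,5)] by (intro grad_eqI) simp
  let ?c = "\<lambda>a. grad (C (a + 1)) xe"
  \<comment> \<open>The Hamiltonian is replaced by \<open>F\<close>, whose gradient vanishes at
    \<open>xe\<close>; this is what makes the second-order argument available.\<close>
  have "\<exists>r>0. cball xe r \<subseteq> \<Omega> \<and> (\<forall>x\<in>cball xe r. F x = F xe \<longrightarrow>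
      (\<forall>k\<in>{1..?n - 2}. C k x = C k xe) \<longrightarrow> x = xe)"
  proof (rule isolated_common_zero[OF assms(2) xe(1)])
    show "C k differentiable (at xe)" if "k \<in> {1..?n - 2}" for k using Cdiff that xe by auto
    show "F differentiable (at x)" if "x \<in> \<Omega>" for x using CinfD0[OF F assms(2) that] .
    show "pd i F differentiable (at xe)" for i using CinfD1[OF F assms(2) xe(1)] .
    fix u assume u: "u \<noteq> 0" "\<And>k. k \<in> {1..?n - 2} \<Longrightarrow> grad (C k) xe \<bullet> u = 0"
    show "(hess F xe *v u) \<bullet> u \<noteq> 0"
    proof (rule no_isotropic_vector[of "?n - 2" _ ?c])
      show "?n - 2 + 2 = ?n" using assms(1) by simp
      show "invertible (hess F xe)"
        using assms(7) by (simp add: non_degenerate_def hessA_def F_def)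
      show "(hess F xe *v x) \<bullet> y = (hess F xe *v y) \<bullet> x" for x y
        by (rule hess_symmetric[OF assms(2) xe(1) F])
      \<comment> \<open>Dividing the invariant by the positive factor
        \<open>(\<nu> xe)\<^sup>2\<close> leaves the required sign condition.\<close>
      have "(\<nu> xe)\<^sup>2 * (det (hess F xe)
          * det_nat (?n - 2) (\<lambda>a b. (matrix_inv (hess F xe) *v ?c a) \<bullet> ?c b)) > 0"
        using assms(8) by (simp add: IX_def hessA_def F_def wedge_inner_def mult.assoc)
      then show "det (hess F xe)
          * det_nat (?n - 2) (\<lambda>a b. (matrix_inv (hess F xe) *v ?c a) \<bullet> ?c b) > 0"
        by (rule zero_less_mult_pos) (use xe in simp)
      show "u \<bullet> ?c a = 0" if "a < ?n - 2" for a
        using u(2)[of "a + 1"] that by (simp add: inner_commute)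
    qed (rule u)
  qed (rule grad_F)
  then obtain r where r: "r > 0" "cball xe r \<subseteq> \<Omega>"
    and iso: "\<And>x. x \<in> cball xe r \<Longrightarrow> F x = F xe \<Longrightarrow> (\<And>k. k \<in> {1..?n - 2} \<Longrightarrow> C k x = C k xe) \<Longrightarrow> x = xe"
    by blast
  obtain L where L: "L-lipschitz_on (cball xe r) (vfX \<nu> C)"
    using lipschitz_vfX[OF assms(1,2) compact_cball convex_cball r(2) assms(3,4)] by blast
  show ?thesis
  proof (rule lyapunov_stable_conserved[OF r L, of V])
    show "continuous_on (cball xe r) V"
      unfolding V_def
      by (intro continuous_intros continuous_at_imp_continuous_on ballI
          differentiable_imp_continuous_within Cdiff) (use r(2) in auto)
    show "V xe = 0" by (simp add: V_def)
    show "V x > 0" if x: "x \<in> cball xe r" "x \<noteq> xe" for x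
    proof (rule ccontr)
      assume "\<not> V x > 0"
      moreover have "V x \<ge> 0" by (simp add: V_def sum_nonneg)
      ultimately have "V x = 0" by simp
      then have "\<forall>k\<in>{1..?n - 1}. (C k x - C k xe)\<^sup>2 = 0"
        unfolding V_def by (subst (asm) sum_nonneg_eq_0_iff) auto
      then have eq: "C k x = C k xe" if "k \<in> {1..?n - 1}" for k using that by simp
      \<comment> \<open>A zero of \<open>V\<close> fixes every \<open>C k\<close>, hence also their
        linear combination \<open>F\<close>.\<close>
      have "F x = F xe"
        unfolding F_def Flam_def using assms(1)
        by (intro arg_cong2[where f="(+)"] sum.cong refl arg_cong2[where f="(*)"] eq) auto
      moreover have "C k x = C k xe" if "k \<in> {1..?n - 2}" for k using that by (intro eq) auto
      ultimately show False using iso[OF x(1)] x(2) by blast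
    qed
    fix \<phi> :: "real \<Rightarrow> (real,'n) vec" and T :: real
    assume T: "0 \<le> T" and sol: "\<And>t. t \<in> {0..T} \<Longrightarrow>
      \<phi> t \<in> \<Omega> \<and> (\<phi> has_vector_derivative vfX \<nu> C (\<phi> t)) (at t within {0..T})"
    have "C k (\<phi> T) = C k (\<phi> 0)" if k: "k \<in> {1..?n - 1}" for k
      by (rule conserved_along_solution[OF T Cdiff[OF k] grad_inner_vfX[OF assms(1) k] sol])
    then show "V (\<phi> T) = V (\<phi> 0)" by (simp add: V_def)
  qed
qed

end
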